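(* Let $\Omega\subset\mathbb R^N$, $N\ge2$, be a smooth bounded domain and let $f:\mathbb R\to[0,+\infty)$ be non-decreasing, with $f(0)>0$ and $f$ of class $C^1$ on $\{t:0<f(t)<f(0)\}$. Assume that $t_0:=\inf\{t\in(-\infty,0):f(t)>0\}\in[-\infty,0)$ is finite, i.e. $t_0\in\mathbb R$. For $\lambda<0$ let $u_\lambda$ be the unique solution to $$-\Delta u=\lambda f(u)\ \text{ in }\Omega,\qquad u=0\ \text{ on }\partial\Omega.$$ Then $$\lambda f(u_\lambda)\to0\quad\text{a.e. in }\Omega\ \text{ as }\lambda\to-\infty,$$ and $u_\lambda\to t_0$ in $C^1_{\mathrm{loc}}(\Omega)$ as $\lambda\to-\infty$.
   Context: For each $\lambda<0$ the Dirichlet problem has a unique solution. *)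

theory Defs
  imports "HOL-Analysis.Analysis"
begin

text \<open>Only meant for open \<open>S\<close>, where it is the usual space of \<open>k\<close> times continuously
  differentiable real functions.\<close>

fun Ck_on :: "nat \<Rightarrow> 'a::euclidean_space set \<Rightarrow> ('a \<Rightarrow> real) \<Rightarrow> bool" where
  "Ck_on 0 S g \<longleftrightarrow> continuous_on S g"
| "Ck_on (Suc k) S g \<longleftrightarrow>
     (\<forall>x\<in>S. g differentiable (at x)) \<and>
     (\<forall>i\<in>Basis. Ck_on k S (\<lambda>x. frechet_derivative g (at x) i))"

definition smooth_on :: "'a::euclidean_space set \<Rightarrow> ('a \<Rightarrow> real) \<Rightarrow> bool" where
  "smooth_on S g \<longleftrightarrow> (\<forall>k. Ck_on k S g)"

definition laplacian :: "('a::euclidean_space \<Rightarrow> real) \<Rightarrow> 'a \<Rightarrow> real" where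
  "laplacian g x =
     (\<Sum>i\<in>Basis. frechet_derivative (\<lambda>y. frechet_derivative g (at y) i) (at x) i)"

text \<open>Near each boundary point the domain lies on one side of a smooth graph, in some orthonormal
  coordinate system. Here \<open>e\<close> is the direction of the graph and only the restriction of \<open>\<gamma>\<close> to the
  hyperplane orthogonal to \<open>e\<close> matters, \<open>x - (x \<bullet> e) *\<^sub>R e\<close> being the projection of \<open>x\<close> to it.\<close>

definition smooth_boundary :: "'a::euclidean_space set \<Rightarrow> bool" where
  "smooth_boundary \<Omega> \<longleftrightarrow>
     (\<forall>p\<in>frontier \<Omega>. \<exists>r>0. \<exists>e \<gamma>. norm e = 1 \<and> smooth_on UNIV \<gamma> \<and>
        \<Omega> \<inter> ball p r = {x \<in> ball p r. x \<bullet> e > \<gamma> (x - (x \<bullet> e) *\<^sub>R e)})"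

definition smooth_bounded_domain :: "'a::euclidean_space set \<Rightarrow> bool" where
  "smooth_bounded_domain \<Omega> \<longleftrightarrow>
     open \<Omega> \<and> connected \<Omega> \<and> \<Omega> \<noteq> {} \<and> bounded \<Omega> \<and> smooth_boundary \<Omega>"

definition test_function :: "'a::euclidean_space set \<Rightarrow> ('a \<Rightarrow> real) \<Rightarrow> bool" where
  "test_function \<Omega> \<phi> \<longleftrightarrow>
     smooth_on UNIV \<phi> \<and> compact (closure {x. \<phi> x \<noteq> 0}) \<and> closure {x. \<phi> x \<noteq> 0} \<subseteq> \<Omega>"

text \<open>Solutions of \<open>-\<Delta>u = \<lambda> f(u)\<close> in \<open>\<Omega>\<close>, \<open>u = 0\<close> on the boundary. As \<open>f\<close> may be discontinuous,
  there need not be any classical solution: the equation is understood in the sense of distributions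
  and the boundary condition pointwise, for \<open>u\<close> continuous up to the boundary. Values of \<open>u\<close>
  outside \<open>closure \<Omega>\<close> are irrelevant.\<close>

definition dirichlet_solution ::
  "'a::euclidean_space set \<Rightarrow> (real \<Rightarrow> real) \<Rightarrow> real \<Rightarrow> ('a \<Rightarrow> real) \<Rightarrow> bool" where
  "dirichlet_solution \<Omega> f l u \<longleftrightarrow>
     continuous_on (closure \<Omega>) u \<and>
     (\<forall>x\<in>frontier \<Omega>. u x = 0) \<and>
     (\<forall>K. compact K \<and> K \<subseteq> \<Omega> \<longrightarrow> set_integrable lebesgue K (\<lambda>x. f (u x))) \<and>
     (\<forall>\<phi>. test_function \<Omega> \<phi> \<longrightarrow>
        - (LINT x:\<Omega>|lebesgue. u x * laplacian \<phi> x) =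
        (LINT x:\<Omega>|lebesgue. l * f (u x) * \<phi> x))"

text \<open>Convergence in \<open>C\<^sup>1\<close> on compact subsets along a filter; members of the family need only
  eventually belong to the space.\<close>

definition C1_loc_tendsto ::
  "'a::euclidean_space set \<Rightarrow> ('i \<Rightarrow> 'a \<Rightarrow> real) \<Rightarrow> ('a \<Rightarrow> real) \<Rightarrow> 'i filter \<Rightarrow> bool" where
  "C1_loc_tendsto \<Omega> u v F \<longleftrightarrow>
     (\<forall>\<^sub>F l in F. Ck_on 1 \<Omega> (u l)) \<and> Ck_on 1 \<Omega> v \<and>
     (\<forall>K. compact K \<and> K \<subseteq> \<Omega> \<longrightarrow>
        uniform_limit K u v F \<and>
        (\<forall>i\<in>Basis. uniform_limit K (\<lambda>l x. frechet_derivative (u l) (at x) i)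
                                   (\<lambda>x. frechet_derivative v (at x) i) F))"

end

theory Submission
  imports Defs
begin

text \<open>
  Put \<open>\<mu> = - l > 0\<close> and \<open>N = DIM('a)\<close>, so that \<open>\<Delta>u = \<mu> f(u) \<ge> 0\<close>. The maximum principle gives \<open>t0 \<le> u \<le> 0\<close>:
  \<open>u\<close> is subharmonic, and it is harmonic where it is below \<open>t0\<close>, because \<open>f\<close> vanishes there. Everything else
  rests on one comparison. Suppose \<open>s < u x\<close>. Wherever \<open>u > s\<close>, monotonicity gives \<open>\<Delta>u \<ge> \<mu> f(s) = \<eta>\<close>, and
  comparing \<open>u\<close> with paraboloids of Laplacian slightly less than \<open>\<eta>\<close> shows that \<open>u\<close> has to rise
  by \<open>\<eta> r\<^sup>2 / (2 N)\<close> on the ball of radius \<open>r\<close> around \<open>x\<close> (\<open>subsolution_growth\<close>). But there is little room to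
  rise.

  \<^item> The total room is \<open>- t0\<close>. As \<open>f s > 0\<close> for every \<open>s > t0\<close>, a point of a compact set with \<open>u x > s\<close> is
    impossible once \<open>\<mu>\<close> is large, so \<open>u \<longlonglongrightarrow> t0\<close> locally uniformly (\<open>eventually_near_threshold\<close>).

  \<^item> Hence the room shrinks to an arbitrarily small \<open>e'\<close> on compact sets, and the same comparison, now with
    \<open>s\<close> increasing to \<open>u x\<close>, yields \<open>\<mu> f(u x) \<le> 2 N e' / r\<^sup>2\<close> (\<open>eventually_reaction_small\<close>): the right hand
    side tends to \<open>0\<close> at every point, and even locally uniformly. Passing to the limit in \<open>s\<close> needs left
    continuity of \<open>f\<close> at values slightly above \<open>t0\<close>, which is what differentiability of \<open>f\<close> on
    \<open>{t. 0 < f t < f 0}\<close> provides (\<open>left_continuous_above_threshold\<close>).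

  \<^item> If \<open>\<bar>u - c\<bar> \<le> M\<close> and \<open>\<bar>\<Delta>u\<bar> \<le> G\<close> near \<open>z\<close>, then every partial derivative at \<open>z\<close> is at most
    \<open>N M / r + G r / 2\<close>. With \<open>c = t0\<close> both \<open>M\<close> and \<open>G\<close> tend to \<open>0\<close>, and so does the gradient.

  The solution is only continuous and solves its equation in the sense of distributions, with a right hand
  side that may jump. So the comparison arguments are made for mollifications of \<open>u\<close>, which are twice
  differentiable, approximate \<open>u\<close> uniformly on compact sets and inherit every one-sided local bound on
  \<open>\<Delta>u\<close> (\<open>weak_poisson_approximation\<close>). Their Laplacians need not converge uniformly, but the gradient
  estimate still shows that \<open>u\<close> is \<open>C\<^sup>1\<close>: for the difference of two mollifications at distance \<open>\<delta>\<close> it reads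
  \<open>N \<delta> / d + G d\<close> on a ball of radius \<open>d\<close>, which is small if first \<open>d\<close> and then \<open>\<delta>\<close> is chosen small. So
  the gradients are uniformly Cauchy (\<open>weak_poisson_gradient\<close>).
\<close>

section \<open>Mollifiers\<close>

text \<open>All derivatives of \<open>exp (- 1 / t)\<close>, extended by \<open>0\<close>, are linear combinations of these functions.\<close>

definition flat_exp :: "nat \<Rightarrow> real \<Rightarrow> real" where
  "flat_exp n t = (if t > 0 then exp (- 1 / t) / t ^ n else 0)"

text \<open>A single term of the exponential series of \<open>1 / t\<close> beats any power of \<open>t\<close>. For \<open>k = 2\<close> this makes the
  function differentiable at \<open>0\<close>.\<close>

lemma flat_exp_le:
  assumes "t > 0"
  shows "flat_exp n t \<le> fact (n + k) * t ^ k"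
proof -
  have "(1 / t) ^ (n + k) / fact (n + k) \<le> exp (1 / t)"
  proof -
    have "(\<Sum>i\<in>{n+k}. (1 / t) ^ i / fact i) \<le> (\<Sum>i. (1 / t) ^ i / fact i)"
      using assms summable_exp[of "1 / t"]
      by (intro sum_le_suminf) (auto simp: divide_inverse mult_ac)
    then show ?thesis
      by (simp add: exp_def divide_inverse mult_ac)
  qed
  then have "exp (- (1 / t)) \<le> fact (n + k) * t ^ (n + k)"
    using assms by (simp add: exp_minus field_simps power_one_over)
  then show ?thesis
    using assms by (simp add: flat_exp_def field_simps power_add)
qed

lemma flat_exp_nonneg: "flat_exp n t \<ge> 0"
  by (simp add: flat_exp_def)

lemma flat_exp_has_derivative:
  "(flat_exp n has_real_derivative (flat_exp (n + 2) t - n * flat_exp (n + 1) t)) (at t)"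
proof (cases t "0::real" rule: linorder_cases)
  case less
  have "((\<lambda>t. 0) has_real_derivative 0) (at t)" by simp
  then have "(flat_exp n has_real_derivative 0) (at t)"
    by (rule DERIV_cong_ev[THEN iffD1, rotated 3])
      (use less in \<open>auto simp: flat_exp_def eventually_nhds intro!: exI[of _ "{..<0}"]\<close>)
  then show ?thesis using less by (simp add: flat_exp_def)
next
  case greater
  have "((\<lambda>t. exp (- 1 / t) / t ^ n) has_real_derivative
          (flat_exp (n + 2) t - n * flat_exp (n + 1) t)) (at t)"
    using greater
    by (auto intro!: derivative_eq_intros simp: flat_exp_def field_simps power2_eq_square)
      (cases n; simp add: field_simps)
  then show ?thesis
    by (rule DERIV_cong_ev[THEN iffD1, rotated 3])
      (use greater in \<open>auto simp: flat_exp_def eventually_nhds intro!: exI[of _ "{0<..}"]\<close>)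
next
  case equal
  have "((\<lambda>h. flat_exp n h / h) \<longlongrightarrow> 0) (at 0)"
  proof (rule Lim_null_comparison)
    show "\<forall>\<^sub>F h in at 0. norm (flat_exp n h / h) \<le> fact (n + 2) * \<bar>h\<bar>"
    proof (rule always_eventually, rule allI)
      fix h :: real
      show "norm (flat_exp n h / h) \<le> fact (n + 2) * \<bar>h\<bar>"
      proof (cases "h > 0")
        case True
        then show ?thesis
          using flat_exp_le[OF True, of n 2] flat_exp_nonneg[of n h]
          by (simp add: field_simps power2_eq_square del: fact_Suc)
      qed (simp add: flat_exp_def mult_nonneg_nonpos del: fact_Suc add_2_eq_Suc')
    qed
    show "((\<lambda>h::real. fact (n + 2) * \<bar>h\<bar>) \<longlongrightarrow> 0) (at 0)"
      by (auto intro!: tendsto_eq_intros simp del: fact_Suc)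
  qed
  then show ?thesis using equal by (simp add: DERIV_def flat_exp_def)
qed

text \<open>An algebra that contains the bump \<open>flat_exp 0 (e\<^sup>2 - x \<bullet> x)\<close> and is closed under directional
  derivatives: smoothness of all its members follows by a trivial induction on the order, without any
  formula for higher derivatives.\<close>

inductive bump_algebra :: "real \<Rightarrow> ('a::euclidean_space \<Rightarrow> real) \<Rightarrow> bool" for e where
  const: "bump_algebra e (\<lambda>x. c)"
| coord: "bump_algebra e (\<lambda>x. x \<bullet> b)"
| flat: "bump_algebra e (\<lambda>x. flat_exp n (e^2 - x \<bullet> x))"
| add: "bump_algebra e g \<Longrightarrow> bump_algebra e k \<Longrightarrow> bump_algebra e (\<lambda>x. g x + k x)"
| mult: "bump_algebra e g \<Longrightarrow> bump_algebra e k \<Longrightarrow> bump_algebra e (\<lambda>x. g x * k x)"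

lemma bump_algebra_derivative:
  assumes "bump_algebra e g"
  shows "\<exists>D. (\<forall>x. (g has_derivative D x) (at x)) \<and> (\<forall>i. bump_algebra e (\<lambda>x. D x i))"
  using assms
proof induction
  case (const c)
  show ?case by (rule exI[of _ "\<lambda>x h. 0"]) (auto intro: bump_algebra.const)
next
  case (coord b)
  show ?case
    by (rule exI[of _ "\<lambda>x h. h \<bullet> b"]) (auto intro: bump_algebra.const derivative_intros)
next
  case (flat n)
  let ?p = "\<lambda>x::'a. e^2 - x \<bullet> x"
  let ?D = "\<lambda>x h::'a. (flat_exp (n + 2) (?p x) + (- real n) * flat_exp (n + 1) (?p x)) *
              ((-2) * (x \<bullet> h))"
  have "((\<lambda>x. flat_exp n (?p x)) has_derivative ?D x) (at x)" for x
  proof -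
    have "(?p has_derivative (\<lambda>h. - (x \<bullet> h + h \<bullet> x))) (at x)"
      by (auto intro!: derivative_eq_intros)
    from DERIV_compose_FDERIV[OF flat_exp_has_derivative this]
    show ?thesis by (simp add: inner_commute algebra_simps)
  qed
  moreover have "bump_algebra e (\<lambda>x. ?D x i)" for i
    by (intro bump_algebra.intros)
  ultimately show ?case by (intro exI[of _ ?D] conjI allI)
next
  case (add g k)
  then obtain D E where D: "\<And>x. (g has_derivative D x) (at x)" "\<And>i. bump_algebra e (\<lambda>x. D x i)"
    and E: "\<And>x. (k has_derivative E x) (at x)" "\<And>i. bump_algebra e (\<lambda>x. E x i)"
    by blast
  show ?case
    by (rule exI[of _ "\<lambda>x h. D x h + E x h"])
      (use D E in \<open>auto intro!: derivative_intros intro: bump_algebra.add\<close>)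
next
  case (mult g k)
  then obtain D E where D: "\<And>x. (g has_derivative D x) (at x)" "\<And>i. bump_algebra e (\<lambda>x. D x i)"
    and E: "\<And>x. (k has_derivative E x) (at x)" "\<And>i. bump_algebra e (\<lambda>x. E x i)"
    by blast
  show ?case
  proof (intro exI[of _ "\<lambda>x h. g x * E x h + D x h * k x"] conjI allI)
    show "((\<lambda>x. g x * k x) has_derivative (\<lambda>h. g x * E x h + D x h * k x)) (at x)" for x
      using D(1) E(1) by (rule has_derivative_mult)
    show "bump_algebra e (\<lambda>x. g x * E x i + D x i * k x)" for i
      by (intro bump_algebra.add bump_algebra.mult mult.hyps D(2) E(2))
  qed
qed

lemma bump_algebra_Ck_on: "bump_algebra e g \<Longrightarrow> Ck_on k UNIV g"
proof (induction k arbitrary: g)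
  case 0
  obtain D where "\<And>x. (g has_derivative D x) (at x)"
    using bump_algebra_derivative[OF 0] by blast
  then show ?case
    by (auto simp: continuous_on_eq_continuous_at intro: has_derivative_continuous)
next
  case (Suc k)
  obtain D where D: "\<And>x. (g has_derivative D x) (at x)" "\<And>i. bump_algebra e (\<lambda>x. D x i)"
    using bump_algebra_derivative[OF Suc.prems] by blast
  have "frechet_derivative g (at x) = D x" for x
    using frechet_derivative_at[OF D(1)] by simp
  then show ?case
    using D Suc.IH by (auto simp: differentiable_def)
qed

lemma mollifier_exists:
  assumes "e > 0"
  obtains \<rho> :: "'a::euclidean_space \<Rightarrow> real"
  where "smooth_on UNIV \<rho>" "\<And>x. \<rho> x \<ge> 0" "\<And>x. norm x \<ge> e \<Longrightarrow> \<rho> x = 0"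
    "(LINT x|lebesgue. \<rho> x) = 1"
proof -
  let ?b = "\<lambda>x::'a. flat_exp 0 (e^2 - x \<bullet> x)"
  let ?I = "LINT x|lebesgue. ?b x"
  have bump: "bump_algebra e ?b" by (rule bump_algebra.flat)
  have cont: "continuous_on UNIV ?b" using bump_algebra_Ck_on[OF bump, of 0] by simp
  have zero: "?b x = 0" if "norm x \<ge> e" for x
    using that \<open>e > 0\<close> power_mono[of e "norm x" 2] by (simp add: flat_exp_def power2_norm_eq_inner)
  have integrable: "integrable lborel ?b"
  proof -
    have "integrable lborel (\<lambda>x. indicator (cball 0 e) x *\<^sub>R ?b x)"
      by (rule borel_integrable_compact) (auto intro: continuous_on_subset[OF cont])
    moreover have "(\<lambda>x. indicator (cball 0 e) x *\<^sub>R ?b x) = ?b"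
      using zero by (auto simp: indicator_def fun_eq_iff not_le)
    ultimately show ?thesis by metis
  qed
  have I_eq: "?I = (LINT x|lborel. ?b x)"
    by (rule integral_completion) (use borel_measurable_continuous_onI[OF cont] in simp)
  have "?I \<noteq> 0"
  proof
    assume "?I = 0"
    then have "AE x in lborel. ?b x = 0"
      using integral_nonneg_eq_0_iff_AE[OF integrable] flat_exp_nonneg I_eq by auto
    then have "AE x in lebesgue. ?b x = 0" by (rule AE_completion)
    moreover have "x \<notin> ball 0 e" if "?b x = 0" for x
    proof
      assume "x \<in> ball 0 e"
      then have "(norm x)^2 < e^2" by (intro power_strict_mono) auto
      then have "e^2 - x \<bullet> x > 0" by (simp add: power2_norm_eq_inner)
      with that show False by (simp add: flat_exp_def)
    qed
    ultimately have "AE x in lebesgue. x \<notin> ball (0::'a) e" by (rule eventually_mono)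
    then have "negligible (ball (0::'a) e)"
      by (subst negligible_iff_null_sets, subst AE_iff_null_sets) auto
    then show False using open_not_negligible[of "ball (0::'a) e"] \<open>e > 0\<close> by auto
  qed
  moreover have "?I \<ge> 0" by (rule integral_nonneg_AE) (auto simp: flat_exp_nonneg)
  ultimately have "?I > 0" by simp
  show thesis
  proof
    have "bump_algebra e (\<lambda>x. (1 / ?I) * ?b x)"
      by (intro bump_algebra.mult bump_algebra.const bump)
    then show "smooth_on UNIV (\<lambda>x. (1 / ?I) * ?b x)"
      by (simp only: smooth_on_def) (use bump_algebra_Ck_on in blast)
  qed (use \<open>?I > 0\<close> zero flat_exp_nonneg in auto)
qed

section \<open>Convolution with smooth kernels\<close>

definition partial :: "'a::euclidean_space \<Rightarrow> ('a \<Rightarrow> real) \<Rightarrow> 'a \<Rightarrow> real" where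
  "partial i g x = frechet_derivative g (at x) i"

definition supported_in_ball :: "real \<Rightarrow> ('a::euclidean_space \<Rightarrow> real) \<Rightarrow> bool" where
  "supported_in_ball e g \<longleftrightarrow> (\<forall>x. norm x > e \<longrightarrow> g x = 0)"

lemma smooth_on_differentiable: "smooth_on S g \<Longrightarrow> x \<in> S \<Longrightarrow> g differentiable (at x)"
  by (drule smooth_on_def[THEN iffD1, THEN spec[of _ "Suc 0"]]) simp

lemma smooth_on_continuous_on: "smooth_on S g \<Longrightarrow> continuous_on S g"
  by (drule smooth_on_def[THEN iffD1, THEN spec[of _ 0]]) simp

lemma smooth_on_partial:
  assumes "smooth_on S g" "i \<in> Basis"
  shows "smooth_on S (partial i g)"
  unfolding smooth_on_def
proof
  fix k
  have "Ck_on (Suc k) S g" using assms by (auto simp: smooth_on_def simp del: Ck_on.simps)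
  then show "Ck_on k S (partial i g)" using assms by (simp add: partial_def[abs_def])
qed

lemma has_derivative_partial:
  fixes g :: "'a::euclidean_space \<Rightarrow> real"
  assumes "g differentiable (at x)"
  shows "(g has_derivative (\<lambda>h. \<Sum>i\<in>Basis. (h \<bullet> i) * partial i g x)) (at x)"
proof -
  have D: "(g has_derivative frechet_derivative g (at x)) (at x)"
    using assms by (simp add: frechet_derivative_works)
  then have lin: "linear (frechet_derivative g (at x))" by (rule has_derivative_linear)
  have "frechet_derivative g (at x) = (\<lambda>h. \<Sum>i\<in>Basis. (h \<bullet> i) * partial i g x)"
  proof (intro ext)
    fix h
    have "frechet_derivative g (at x) h =
        frechet_derivative g (at x) (\<Sum>i\<in>Basis. (h \<bullet> i) *\<^sub>R i)"
      by (simp only: euclidean_representation)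
    also have "\<dots> = (\<Sum>i\<in>Basis. (h \<bullet> i) * partial i g x)"
      by (simp only: linear_sum[OF lin] linear_cmul[OF lin] partial_def real_scaleR_def)
    finally show "frechet_derivative g (at x) h = (\<Sum>i\<in>Basis. (h \<bullet> i) * partial i g x)" .
  qed
  then show ?thesis using D by simp
qed

lemma partial_eqI:
  assumes "(g has_derivative D) (at x)"
  shows "partial i g x = D i"
  using frechet_derivative_at[OF assms] by (simp add: partial_def)

lemma partial_translate:
  assumes "g differentiable (at (y - x))"
  shows "partial i (\<lambda>y. g (y - x)) y = partial i g (y - x)"
proof -
  have "((\<lambda>y. y - x) has_derivative (\<lambda>h. h)) (at y)" by (auto intro!: derivative_eq_intros)
  from has_derivative_compose[OF this has_derivative_partial[OF assms]]
  have "((\<lambda>y. g (y - x)) has_derivative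
      (\<lambda>h. \<Sum>i\<in>Basis. (h \<bullet> i) * partial i g (y - x))) (at y)" .
  from partial_eqI[OF this] partial_eqI[OF has_derivative_partial[OF assms]]
  show ?thesis by (rule trans[OF _ sym])
qed

lemma Ck_on_translate: "Ck_on k UNIV g \<Longrightarrow> Ck_on k UNIV (\<lambda>y. g (y - x))"
proof (induction k arbitrary: g)
  case 0
  have "continuous_on UNIV (g \<circ> (\<lambda>y. y - x))"
    using 0 by (intro continuous_on_compose continuous_intros) (auto intro: continuous_on_subset)
  then show ?case by (simp add: o_def)
next
  case (Suc k)
  have diff: "g differentiable (at y)" for y
    using Suc.prems by simp
  have partial_eq: "(\<lambda>y. frechet_derivative (\<lambda>y. g (y - x)) (at y) i) =
        (\<lambda>y. frechet_derivative g (at (y - x)) i)" for i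
    using partial_translate[OF diff] unfolding partial_def by (rule ext)
  have "(g \<circ> (\<lambda>y. y - x)) differentiable (at y)" for y
    by (rule differentiable_chain_at[OF _ diff]) (intro derivative_intros)
  then have "(\<lambda>y. g (y - x)) differentiable (at y)" for y
    by (simp only: o_def)
  moreover have "Ck_on k UNIV (\<lambda>y. frechet_derivative g (at (y - x)) i)" if "i \<in> Basis" for i
    using Suc.IH[of "\<lambda>y. frechet_derivative g (at y) i"] Suc.prems that by simp
  ultimately show ?case
    unfolding Ck_on.simps partial_eq by blast
qed

lemma smooth_on_translate: "smooth_on UNIV g \<Longrightarrow> smooth_on UNIV (\<lambda>y. g (y - x))"
  by (simp add: smooth_on_def Ck_on_translate)

lemma laplacian_translate:
  assumes "smooth_on UNIV g"
  shows "laplacian (\<lambda>y. g (y - x)) y = (\<Sum>i\<in>Basis. partial i (partial i g) (y - x))"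
proof -
  have 1: "partial i (\<lambda>y. g (y - x)) = (\<lambda>y. partial i g (y - x))" for i
    using partial_translate[OF smooth_on_differentiable[OF assms UNIV_I]] by (rule ext)
  have 2: "partial i (\<lambda>y. partial i g (y - x)) y = partial i (partial i g) (y - x)"
    if "i \<in> Basis" for i
    by (rule partial_translate[OF smooth_on_differentiable[OF smooth_on_partial[OF assms that] UNIV_I]])
  have "laplacian (\<lambda>y. g (y - x)) y =
      (\<Sum>i\<in>Basis. partial i (partial i (\<lambda>y. g (y - x))) y)"
    unfolding laplacian_def partial_def ..
  then show ?thesis
    unfolding 1 using 2 by simp
qed

text \<open>Outside the closed ball the function vanishes on a neighbourhood.\<close>

lemma supported_in_ball_partial:
  assumes "supported_in_ball e g"
  shows "supported_in_ball e (partial i g)"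
  unfolding supported_in_ball_def
proof (intro allI impI)
  fix x :: 'a assume "norm x > e"
  have "open {x::'a. norm x > e}"
    by (intro open_Collect_less continuous_intros)
  then have "(g has_derivative (\<lambda>h. 0)) (at x)"
  proof (rule has_derivative_transform_within_open[rotated])
    show "((\<lambda>_. 0) has_derivative (\<lambda>h. 0)) (at x)" by simp
  qed (use assms \<open>norm x > e\<close> in \<open>simp_all add: supported_in_ball_def\<close>)
  then show "partial i g x = 0" by (rule partial_eqI)
qed

lemma supported_uniformly_continuous:
  fixes g :: "'a::euclidean_space \<Rightarrow> real"
  assumes "continuous_on UNIV g" "supported_in_ball e g"
  shows "uniformly_continuous_on UNIV g"
proof -
  have "uniformly_continuous_on (cball 0 (e + 1)) g"
    by (intro compact_uniformly_continuous continuous_on_subset[OF assms(1)]) auto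
  show ?thesis
    unfolding uniformly_continuous_on_def
  proof (intro allI impI)
    fix c :: real assume "c > 0"
    then obtain d where "d > 0" and
      d: "\<And>x y. x \<in> cball 0 (e+1) \<Longrightarrow> y \<in> cball 0 (e+1) \<Longrightarrow> dist y x < d \<Longrightarrow> dist (g y) (g x) < c"
      using \<open>uniformly_continuous_on (cball 0 (e + 1)) g\<close>
      unfolding uniformly_continuous_on_def by metis
    have near: "dist (g y) (g x) < c" if "dist y x < min d 1" for x y
    proof (cases "norm x \<le> e + 1 \<and> norm y \<le> e + 1")
      case True
      then show ?thesis using d[of x y] that by simp
    next
      case False
      have "norm x \<le> norm y + dist y x" "norm y \<le> norm x + dist y x"
        using dist_triangle[of 0 x y] dist_triangle[of 0 y x] by (simp_all add: dist_commute)
      then have "norm x > e \<and> norm y > e" using that False by auto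
      then show ?thesis using assms(2) \<open>c > 0\<close> by (simp add: supported_in_ball_def)
    qed
    then show "\<exists>d>0. \<forall>x\<in>UNIV. \<forall>y\<in>UNIV. dist y x < d \<longrightarrow> dist (g y) (g x) < c"
      using \<open>d > 0\<close> by (intro exI[of _ "min d 1"] conjI ballI impI near) simp
  qed
qed

lemma supported_bounded:
  fixes g :: "'a::euclidean_space \<Rightarrow> real"
  assumes "continuous_on UNIV g" "supported_in_ball e g"
  obtains C where "\<And>x. \<bar>g x\<bar> \<le> C"
proof -
  have "compact (g ` cball 0 e)"
    by (intro compact_continuous_image continuous_on_subset[OF assms(1)]) auto
  then have "bounded (g ` cball 0 e)" by (rule compact_imp_bounded)
  then obtain C where C: "\<forall>y\<in>g ` cball 0 e. norm y \<le> C"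
    unfolding bounded_iff by blast
  have "\<bar>g x\<bar> \<le> max C 0" for x
  proof (cases "norm x > e")
    case False
    then have "norm (g x) \<le> C" using C by (intro bspec[OF C] imageI) simp
    then show ?thesis by simp
  qed (use assms(2) in \<open>simp add: supported_in_ball_def\<close>)
  then show thesis by (rule that)
qed

text \<open>Because the derivative is uniformly continuous, the remainder of the linear approximation is small
  uniformly in the base point. This uniformity is what allows differentiation under the integral.\<close>

lemma smooth_supported_taylor:
  fixes g :: "'a::euclidean_space \<Rightarrow> real"
  assumes "smooth_on UNIV g" "supported_in_ball e g" "c > 0"
  obtains d where "d > 0"
    "\<And>p q. norm (q - p) < d \<Longrightarrow>
       \<bar>g q - g p - (\<Sum>i\<in>Basis. ((q - p) \<bullet> i) * partial i g p)\<bar> \<le> c * norm (q - p)"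
proof -
  define c' where "c' = c / DIM('a)"
  have "c' > 0" using assms by (simp add: c'_def)
  have "\<forall>i\<in>Basis. \<exists>d. d > 0 \<and>
      (\<forall>p q. dist q p < d \<longrightarrow> dist (partial i g q) (partial i g p) < c')"
  proof
    fix i :: 'a assume i: "i \<in> Basis"
    have "uniformly_continuous_on UNIV (partial i g)"
      using smooth_on_continuous_on[OF smooth_on_partial[OF assms(1) i]]
        supported_in_ball_partial[OF assms(2)]
      by (rule supported_uniformly_continuous)
    then show "\<exists>d. d > 0 \<and> (\<forall>p q. dist q p < d \<longrightarrow> dist (partial i g q) (partial i g p) < c')"
      unfolding uniformly_continuous_on_def using \<open>c' > 0\<close> by blast
  qed
  from bchoice[OF this] obtain d where "\<forall>i\<in>Basis. d i > 0 \<and>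
      (\<forall>p q. dist q p < d i \<longrightarrow> dist (partial i g q) (partial i g p) < c')" ..
  then have d: "\<And>i. i \<in> Basis \<Longrightarrow> d i > 0"
    "\<And>i p q. i \<in> Basis \<Longrightarrow> dist q p < d i \<Longrightarrow> dist (partial i g q) (partial i g p) < c'"
    by blast+
  define m where "m = Min (d ` Basis)"
  have "m > 0" using d(1) by (simp add: m_def)
  have m: "\<bar>partial i g q - partial i g p\<bar> < c'" if "i \<in> Basis" "norm (q - p) < m" for i p q
  proof -
    have "m \<le> d i" unfolding m_def using that(1) by (intro Min_le) auto
    then show ?thesis using d(2)[OF that(1), of q p] that(2) by (simp add: dist_norm)
  qed
  show thesis
  proof (rule that[OF \<open>m > 0\<close>])
    fix p q :: 'a assume pq: "norm (q - p) < m"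
    let ?D = "\<lambda>x h. \<Sum>i\<in>Basis. (h \<bullet> i) * partial i g x"
    have "norm (g q - g p - ?D p (q - p)) \<le> norm (q - p) * c"
    proof (rule differentiable_bound_linearization[where S = "ball p m" and ?x0.0 = p])
      show "p + t *\<^sub>R (q - p) \<in> ball p m" if "t \<in> {0..1}" for t
      proof -
        have "\<bar>t\<bar> * norm (q - p) \<le> 1 * norm (q - p)"
          using that by (intro mult_right_mono) auto
        then show ?thesis using pq by (simp add: dist_norm)
      qed
      show "(g has_derivative ?D x) (at x within ball p m)" for x
        by (rule has_derivative_at_withinI[OF has_derivative_partial[OF
              smooth_on_differentiable[OF assms(1) UNIV_I]]])
      show "onorm (?D x - ?D p) \<le> c" if "x \<in> ball p m" for x
      proof (rule onorm_le)
        fix h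
        have "norm ((?D x - ?D p) h) = \<bar>\<Sum>i\<in>Basis. (h \<bullet> i) * (partial i g x - partial i g p)\<bar>"
          by (simp add: right_diff_distrib sum_subtractf)
        also have "\<dots> \<le> (\<Sum>i\<in>Basis. \<bar>(h \<bullet> i) * (partial i g x - partial i g p)\<bar>)"
          by (rule sum_abs)
        also have "\<dots> \<le> (\<Sum>i\<in>(Basis::'a set). norm h * c')"
        proof (rule sum_mono)
          fix i :: 'a assume i: "i \<in> Basis"
          have "norm (x - p) < m" using that by (simp add: dist_norm norm_minus_commute)
          then show "\<bar>(h \<bullet> i) * (partial i g x - partial i g p)\<bar> \<le> norm h * c'"
            unfolding abs_mult using Basis_le_norm[OF i, of h] m[OF i, of x p]
            by (intro mult_mono) auto
        qed
        also have "\<dots> = c * norm h" by (simp add: c'_def)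
        finally show "norm ((?D x - ?D p) h) \<le> c * norm h" .
      qed
    qed (use \<open>m > 0\<close> in auto)
    then show "\<bar>g q - g p - ?D p (q - p)\<bar> \<le> c * norm (q - p)" by (simp add: mult.commute)
  qed
qed

text \<open>Convolution with the reflected kernel. With \<open>y - x\<close> instead of \<open>x - y\<close> the kernel is a translate of \<open>\<psi>\<close>,
  and so a test function to which the weak equation applies directly.\<close>

definition correlation :: "('a::euclidean_space \<Rightarrow> real) \<Rightarrow> ('a \<Rightarrow> real) \<Rightarrow> 'a \<Rightarrow> real" where
  "correlation a \<psi> x = (LINT y|lebesgue. a y * \<psi> (y - x))"

lemma integrable_correlation:
  fixes a :: "'a::euclidean_space \<Rightarrow> real"
  assumes "integrable lebesgue a" "continuous_on UNIV \<psi>" "supported_in_ball e \<psi>"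
  shows "integrable lebesgue (\<lambda>y. a y * \<psi> (y - x))"
proof -
  obtain C where C: "\<And>x. \<bar>\<psi> x\<bar> \<le> C" using supported_bounded[OF assms(2,3)] by blast
  have "continuous_on UNIV (\<lambda>y. \<psi> (y - x))"
    using assms(2) by (auto intro!: continuous_on_compose2[of UNIV \<psi>] continuous_intros)
  then have [measurable]: "(\<lambda>y. \<psi> (y - x)) \<in> borel_measurable lebesgue"
    by (intro measurable_completion) (simp add: borel_measurable_continuous_onI)
  show ?thesis
  proof (rule Bochner_Integration.integrable_bound)
    show "integrable lebesgue (\<lambda>y. C * a y)" using assms by simp
    show "(\<lambda>y. a y * \<psi> (y - x)) \<in> borel_measurable lebesgue"
      using assms(1) by measurable
    show "AE y in lebesgue. norm (a y * \<psi> (y - x)) \<le> norm (C * a y)"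
    proof (rule AE_I2)
      fix y
      have "\<bar>\<psi> (y - x)\<bar> * \<bar>a y\<bar> \<le> \<bar>C\<bar> * \<bar>a y\<bar>"
        using C[of "y - x"] by (intro mult_right_mono) auto
      then show "norm (a y * \<psi> (y - x)) \<le> norm (C * a y)" by (simp add: abs_mult mult.commute)
    qed
  qed
qed

text \<open>The kernel moves against \<open>x\<close>, hence the minus sign.\<close>

lemma correlation_has_derivative:
  fixes a :: "'a::euclidean_space \<Rightarrow> real"
  assumes a: "integrable lebesgue a" and \<psi>: "smooth_on UNIV \<psi>" "supported_in_ball e \<psi>"
  shows "(correlation a \<psi> has_derivative
           (\<lambda>h. \<Sum>i\<in>Basis. (h \<bullet> i) * - correlation a (partial i \<psi>) x)) (at x)"
proof -
  let ?D = "\<lambda>h. \<Sum>i\<in>Basis. (h \<bullet> i) * - correlation a (partial i \<psi>) x"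
  have int: "integrable lebesgue (\<lambda>z. a z * \<psi> (z - y))" for y
    using integrable_correlation[OF a smooth_on_continuous_on \<psi>(2), OF \<psi>(1)] .
  have int': "integrable lebesgue (\<lambda>z. a z * partial i \<psi> (z - x))" if "i \<in> Basis" for i
    using integrable_correlation[OF a smooth_on_continuous_on supported_in_ball_partial,
        OF smooth_on_partial \<psi>(2), OF \<psi>(1) that] .
  define A where "A = (LINT z|lebesgue. \<bar>a z\<bar>)"
  have "A \<ge> 0" by (simp add: A_def)
  have "\<exists>d>0. \<forall>y. norm (y - x) < d \<longrightarrow>
      norm (correlation a \<psi> y - correlation a \<psi> x - ?D (y - x)) \<le> c * norm (y - x)" if "c > 0" for c
  proof -
    have "c / (A + 1) > 0" using \<open>A \<ge> 0\<close> that by simp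
    from smooth_supported_taylor[OF \<psi> this] obtain d where "d > 0" and
      d: "\<And>p q. norm (q - p) < d \<Longrightarrow>
       \<bar>\<psi> q - \<psi> p - (\<Sum>i\<in>Basis. ((q - p) \<bullet> i) * partial i \<psi> p)\<bar> \<le> c / (A + 1) * norm (q - p)"
      by blast
    have "norm (correlation a \<psi> y - correlation a \<psi> x - ?D (y - x)) \<le> c * norm (y - x)"
      if "norm (y - x) < d" for y
    proof -
      let ?E = "\<lambda>z. a z * (\<psi> (z - y) - \<psi> (z - x) + (\<Sum>i\<in>Basis. ((y - x) \<bullet> i) * partial i \<psi> (z - x)))"
      let ?R = "\<lambda>z. \<Sum>i\<in>Basis. ((y - x) \<bullet> i) * (a z * partial i \<psi> (z - x))"
      have R_int: "integrable lebesgue ?R"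
        using int' by (intro Bochner_Integration.integrable_sum integrable_mult_right)
      have R_eq: "(LINT z|lebesgue. ?R z) = - ?D (y - x)"
        using int' by (subst Bochner_Integration.integral_sum) (auto simp: correlation_def sum_negf)
      have E_eq: "?E z = a z * \<psi> (z - y) - a z * \<psi> (z - x) +
          (\<Sum>i\<in>Basis. ((y - x) \<bullet> i) * (a z * partial i \<psi> (z - x)))" for z
        by (simp add: algebra_simps sum_distrib_left)
      have E_int: "integrable lebesgue ?E"
        unfolding E_eq using int R_int
        by (intro Bochner_Integration.integrable_add Bochner_Integration.integrable_diff)
      have "correlation a \<psi> y - correlation a \<psi> x - ?D (y - x) = (LINT z|lebesgue. ?E z)"
        unfolding E_eq using int[of y] int[of x] R_int R_eq
          Bochner_Integration.integral_add[OF Bochner_Integration.integrable_diff[OF int[of y] int[of x]] R_int]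
          Bochner_Integration.integral_diff[OF int[of y] int[of x]]
        by (simp only: correlation_def)
      also have "norm \<dots> \<le> (LINT z|lebesgue. \<bar>a z\<bar> * (c / (A + 1) * norm (y - x)))"
      proof (rule Bochner_Integration.integral_norm_bound_integral)
        fix z
        have "\<bar>\<psi> (z - y) - \<psi> (z - x) + (\<Sum>i\<in>Basis. ((y - x) \<bullet> i) * partial i \<psi> (z - x))\<bar>
            \<le> c / (A + 1) * norm (y - x)"
          using d[of "z - y" "z - x"] that
          by (simp add: norm_minus_commute inner_diff_left sum_subtractf algebra_simps)
        then show "norm (?E z) \<le> \<bar>a z\<bar> * (c / (A + 1) * norm (y - x))"
          by (auto simp only: real_norm_def abs_mult intro!: mult_left_mono)
      qed (use E_int a in auto)
      also have "\<dots> = A / (A + 1) * c * norm (y - x)" by (simp add: A_def)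
      also have "\<dots> \<le> c * norm (y - x)"
        using \<open>A \<ge> 0\<close> \<open>c > 0\<close> by (intro mult_right_mono) (auto simp: field_simps)
      finally show ?thesis .
    qed
    then show ?thesis using \<open>d > 0\<close> by blast
  qed
  moreover have "bounded_linear ?D"
    by (rule bounded_linear_sum)
      (rule bounded_linear_compose[OF bounded_linear_mult_left bounded_linear_inner_left])
  ultimately show ?thesis
    by (simp add: has_derivative_at_alt)
qed

lemma lebesgue_integral_translate:
  fixes \<rho> :: "'a::euclidean_space \<Rightarrow> real"
  assumes "continuous_on UNIV \<rho>"
  shows "(LINT y|lebesgue. \<rho> (y - x)) = (LINT y|lebesgue. \<rho> y)"
proof -
  have [measurable]: "\<rho> \<in> borel_measurable borel"
    using borel_measurable_continuous_onI[OF assms] .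
  have "(LINT y|lborel. \<rho> (y - x)) = (LINT y|distr lborel borel ((+) (- x)). \<rho> y)"
    by (subst integral_distr) auto
  then show ?thesis
    by (simp add: integral_completion lborel_distr_plus)
qed

lemma correlation_ge:
  fixes a :: "'a::euclidean_space \<Rightarrow> real"
  assumes a: "integrable lebesgue a" and
    \<rho>: "continuous_on UNIV \<rho>" "\<And>x. \<rho> x \<ge> 0" "\<And>x. norm x \<ge> e \<Longrightarrow> \<rho> x = 0" "(LINT x|lebesgue. \<rho> x) = 1"
    and c: "\<And>y. y \<in> ball x e \<Longrightarrow> c \<le> a y"
  shows "c \<le> correlation a \<rho> x"
proof -
  have supp: "supported_in_ball e \<rho>" using \<rho>(3) by (simp add: supported_in_ball_def)
  have "integrable lebesgue (\<lambda>y. \<rho> (y - x))"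
    using lebesgue_integral_translate[OF \<rho>(1), of x] \<rho>(4) not_integrable_integral_eq by fastforce
  then have "(LINT y|lebesgue. c * \<rho> (y - x)) \<le> correlation a \<rho> x"
    unfolding correlation_def
  proof (intro integral_mono integrable_correlation[OF a \<rho>(1) supp] integrable_mult_right)
    fix y
    show "c * \<rho> (y - x) \<le> a y * \<rho> (y - x)"
      using c[of y] \<rho>(2,3)[of "y - x"]
      by (cases "y \<in> ball x e") (auto simp: dist_norm norm_minus_commute intro: mult_right_mono)
  qed
  then show ?thesis using lebesgue_integral_translate[OF \<rho>(1), of x] \<rho>(4) by simp
qed

section \<open>Mollified weak solutions\<close>

text \<open>The equation \<open>\<Delta>u = g\<close> in the sense of distributions.\<close>

definition weak_poisson :: "'a::euclidean_space set \<Rightarrow> ('a \<Rightarrow> real) \<Rightarrow> ('a \<Rightarrow> real) \<Rightarrow> bool" where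
  "weak_poisson \<Omega> u g \<longleftrightarrow>
     open \<Omega> \<and> continuous_on \<Omega> u \<and> set_integrable lebesgue \<Omega> u \<and> set_integrable lebesgue \<Omega> g \<and>
     (\<forall>\<phi>. test_function \<Omega> \<phi> \<longrightarrow>
        (LINT x:\<Omega>|lebesgue. u x * laplacian \<phi> x) = (LINT x:\<Omega>|lebesgue. g x * \<phi> x))"

text \<open>\<open>D i\<close> and \<open>H i\<close> are the first and the pure second partial derivatives. Second derivatives are taken along
  coordinate lines, which is how the maximum principle sees the Laplacian \<open>\<Sum>i\<in>Basis. H i x\<close>.\<close>

definition C2_derivatives ::
  "('a::euclidean_space \<Rightarrow> real) \<Rightarrow> ('a \<Rightarrow> 'a \<Rightarrow> real) \<Rightarrow> ('a \<Rightarrow> 'a \<Rightarrow> real) \<Rightarrow> bool" where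
  "C2_derivatives U D H \<longleftrightarrow>
     (\<forall>x. (U has_derivative (\<lambda>h. \<Sum>i\<in>Basis. (h \<bullet> i) * D i x)) (at x)) \<and>
     (\<forall>i\<in>Basis. \<forall>x. ((\<lambda>t. D i (x + t *\<^sub>R i)) has_real_derivative H i x) (at 0))"

lemma has_derivative_along_line:
  fixes U :: "'a::euclidean_space \<Rightarrow> real"
  assumes "(U has_derivative (\<lambda>h. \<Sum>i\<in>Basis. (h \<bullet> i) * D i (x + t *\<^sub>R j))) (at (x + t *\<^sub>R j))"
    and j: "j \<in> Basis"
  shows "((\<lambda>t. U (x + t *\<^sub>R j)) has_real_derivative D j (x + t *\<^sub>R j)) (at t)"
proof -
  have line: "((\<lambda>t. x + t *\<^sub>R j) has_derivative (\<lambda>s. s *\<^sub>R j)) (at t)"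
    by (auto intro!: derivative_eq_intros)
  have "(\<Sum>i\<in>Basis. ((s *\<^sub>R j) \<bullet> i) * D i (x + t *\<^sub>R j)) = s * D j (x + t *\<^sub>R j)" for s
  proof -
    have "(\<Sum>i\<in>Basis. ((s *\<^sub>R j) \<bullet> i) * D i (x + t *\<^sub>R j)) =
        (\<Sum>i\<in>Basis. if i = j then s * D j (x + t *\<^sub>R j) else 0)"
      using j by (intro sum.cong) (auto simp: inner_Basis)
    then show ?thesis using j by simp
  qed
  with has_derivative_compose[OF line assms(1)]
  have "((\<lambda>t. U (x + t *\<^sub>R j)) has_derivative (\<lambda>s. s * D j (x + t *\<^sub>R j))) (at t)" by simp
  then show ?thesis
    by (simp add: has_field_derivative_def mult_commute_abs)
qed

lemma C2_derivatives_line: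
  assumes "C2_derivatives U D H" "i \<in> Basis"
  shows "((\<lambda>t. U (x + t *\<^sub>R i)) has_real_derivative D i (x + t *\<^sub>R i)) (at t)"
    and "((\<lambda>t. D i (x + t *\<^sub>R i)) has_real_derivative H i x) (at 0)"
  using assms has_derivative_along_line[of U D x t i] unfolding C2_derivatives_def by blast+

lemma C2_derivatives_continuous: "C2_derivatives U D H \<Longrightarrow> continuous_on S U"
  unfolding C2_derivatives_def
  by (meson continuous_at_imp_continuous_on has_derivative_continuous)

lemma second_derivative_test:
  fixes p p' :: "real \<Rightarrow> real"
  assumes p: "\<And>t. (p has_real_derivative p' t) (at t)" and p': "(p' has_real_derivative c) (at 0)"
    and "r > 0" and max: "\<And>t. \<bar>t\<bar> < r \<Longrightarrow> p t \<le> p 0"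
  shows "c \<le> 0"
proof (rule ccontr)
  assume "\<not> c \<le> 0"
  then have "c > 0" by simp
  have "p' 0 = 0"
    by (rule DERIV_local_max[OF p \<open>r > 0\<close>]) (use max in auto)
  with DERIV_pos_inc_right[OF p' \<open>c > 0\<close>] obtain d where "d > 0"
    and d: "\<And>h. 0 < h \<Longrightarrow> h < d \<Longrightarrow> 0 < p' h"
    by auto
  define s where "s = min d r / 2"
  have s: "0 < s" "s < d" "s < r" using \<open>d > 0\<close> \<open>r > 0\<close> by (auto simp: s_def)
  obtain z where "0 < z" "z < s" "p s - p 0 = (s - 0) * p' z"
    using MVT2[of 0 s p p'] p s by auto
  moreover have "(s - 0) * p' z > 0"
    using d[of z] s \<open>0 < z\<close> \<open>z < s\<close> by (intro mult_pos_pos) auto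
  ultimately have "p s > p 0" by simp
  with max[of s] s show False by simp
qed

lemma C2_derivatives_local_max:
  assumes C2: "C2_derivatives U D H" and i: "i \<in> Basis"
    and "r > 0" and max: "\<And>y. y \<in> ball z r \<Longrightarrow> U y \<le> U z"
  shows "H i z \<le> 0"
proof (rule second_derivative_test[where p = "\<lambda>t. U (z + t *\<^sub>R i)"])
  show "((\<lambda>t. U (z + t *\<^sub>R i)) has_real_derivative D i (z + t *\<^sub>R i)) (at t)" for t
    using C2_derivatives_line(1)[OF C2 i] .
  show "((\<lambda>t. D i (z + t *\<^sub>R i)) has_real_derivative H i z) (at 0)"
    using C2_derivatives_line(2)[OF C2 i] .
  show "U (z + t *\<^sub>R i) \<le> U (z + 0 *\<^sub>R i)" if "\<bar>t\<bar> < r" for t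
    using max[of "z + t *\<^sub>R i"] that i by (simp add: dist_norm)
qed (fact \<open>r > 0\<close>)

lemma C2_derivatives_add:
  assumes "C2_derivatives U D H" "C2_derivatives V E I"
  shows "C2_derivatives (\<lambda>x. U x + V x) (\<lambda>i x. D i x + E i x) (\<lambda>i x. H i x + I i x)"
  unfolding C2_derivatives_def
proof (intro conjI allI ballI)
  fix x
  have "((\<lambda>x. U x + V x) has_derivative (\<lambda>h. (\<Sum>i\<in>Basis. (h \<bullet> i) * D i x) +
      (\<Sum>i\<in>Basis. (h \<bullet> i) * E i x))) (at x)"
    using assms unfolding C2_derivatives_def by (intro has_derivative_add) blast+
  then show "((\<lambda>x. U x + V x) has_derivative (\<lambda>h. \<Sum>i\<in>Basis. (h \<bullet> i) * (D i x + E i x))) (at x)"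
    by (simp only: distrib_left sum.distrib)
next
  fix x i :: 'a assume "i \<in> Basis"
  then show "((\<lambda>t. D i (x + t *\<^sub>R i) + E i (x + t *\<^sub>R i)) has_real_derivative H i x + I i x) (at 0)"
    using assms unfolding C2_derivatives_def by (intro DERIV_add) blast+
qed

lemma C2_derivatives_cmult:
  assumes "C2_derivatives U D H"
  shows "C2_derivatives (\<lambda>x. c * U x) (\<lambda>i x. c * D i x) (\<lambda>i x. c * H i x)"
  unfolding C2_derivatives_def
proof (intro conjI allI ballI)
  fix x
  have "((\<lambda>x. c * U x) has_derivative (\<lambda>h. c * (\<Sum>i\<in>Basis. (h \<bullet> i) * D i x))) (at x)"
    using assms unfolding C2_derivatives_def by (intro has_derivative_mult_right) blast
  then show "((\<lambda>x. c * U x) has_derivative (\<lambda>h. \<Sum>i\<in>Basis. (h \<bullet> i) * (c * D i x))) (at x)"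
    by (simp only: sum_distrib_left mult.left_commute)
next
  fix x i :: 'a assume "i \<in> Basis"
  then show "((\<lambda>t. c * D i (x + t *\<^sub>R i)) has_real_derivative c * H i x) (at 0)"
    using assms unfolding C2_derivatives_def by (intro DERIV_cmult) blast
qed

lemma C2_derivatives_const: "C2_derivatives (\<lambda>x. c) (\<lambda>i x. 0) (\<lambda>i x. 0)"
  by (simp add: C2_derivatives_def)

lemma C2_derivatives_square_dist:
  "C2_derivatives (\<lambda>x. (norm (x - z))^2) (\<lambda>i x. 2 * ((x - z) \<bullet> i)) (\<lambda>i x. 2)"
  unfolding C2_derivatives_def
proof (intro conjI allI ballI)
  fix x :: 'a
  have "((\<lambda>x. (norm (x - z))^2) has_derivative (\<lambda>h. 2 * (h \<bullet> (x - z)))) (at x)"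
    unfolding power2_norm_eq_inner by (auto intro!: derivative_eq_intros simp: inner_commute)
  then show "((\<lambda>x. (norm (x - z))^2) has_derivative
      (\<lambda>h. \<Sum>i\<in>Basis. (h \<bullet> i) * (2 * ((x - z) \<bullet> i)))) (at x)"
    by (subst (asm) euclidean_inner) (simp add: sum_distrib_left mult.left_commute)
next
  fix x i :: 'a assume "i \<in> Basis"
  then show "((\<lambda>t. 2 * ((x + t *\<^sub>R i - z) \<bullet> i)) has_real_derivative 2) (at 0)"
    by (auto intro!: derivative_eq_intros simp: inner_add_left inner_diff_left)
qed

lemma C2_derivatives_coordinate:
  assumes "j \<in> Basis"
  shows "C2_derivatives (\<lambda>x. (x - z) \<bullet> j) (\<lambda>i x. if i = j then 1 else 0) (\<lambda>i x. 0)"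
  unfolding C2_derivatives_def
proof (intro conjI allI ballI)
  fix x :: 'a
  have "((\<lambda>x. (x - z) \<bullet> j) has_derivative (\<lambda>h. h \<bullet> j)) (at x)"
    by (auto intro!: derivative_eq_intros)
  moreover have "(\<Sum>i\<in>Basis. (h \<bullet> i) * (if i = j then 1 else 0)) = h \<bullet> j" for h
    using assms by (simp add: if_distrib cong: if_cong)
  ultimately show "((\<lambda>x. (x - z) \<bullet> j) has_derivative
      (\<lambda>h. \<Sum>i\<in>Basis. (h \<bullet> i) * (if i = j then 1 else 0))) (at x)"
    by simp
qed simp

lemma C2_derivatives_coordinate_square:
  assumes "j \<in> Basis"
  shows "C2_derivatives (\<lambda>x. ((x - z) \<bullet> j)^2)
    (\<lambda>i x. if i = j then 2 * ((x - z) \<bullet> j) else 0) (\<lambda>i x. if i = j then 2 else 0)"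
  unfolding C2_derivatives_def
proof (intro conjI allI ballI)
  fix x :: 'a
  have "((\<lambda>x. ((x - z) \<bullet> j)^2) has_derivative (\<lambda>h. (h \<bullet> j) * (2 * ((x - z) \<bullet> j)))) (at x)"
    by (auto intro!: derivative_eq_intros)
  moreover have "(\<Sum>i\<in>Basis. (h \<bullet> i) * (if i = j then 2 * ((x - z) \<bullet> j) else 0)) =
      (h \<bullet> j) * (2 * ((x - z) \<bullet> j))" for h
    using assms by (simp add: if_distrib cong: if_cong)
  ultimately show "((\<lambda>x. ((x - z) \<bullet> j)^2) has_derivative
      (\<lambda>h. \<Sum>i\<in>Basis. (h \<bullet> i) * (if i = j then 2 * ((x - z) \<bullet> j) else 0))) (at x)"
    by simp
next
  fix x i :: 'a assume "i \<in> Basis"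
  then show "((\<lambda>t. if i = j then 2 * ((x + t *\<^sub>R i - z) \<bullet> j) else 0) has_real_derivative
      (if i = j then 2 else 0)) (at 0)"
    by (auto intro!: derivative_eq_intros simp: inner_add_left inner_diff_left)
qed

text \<open>Testing the equation with translates of a mollifier shows that the Laplacian of the mollified function
  is the mollified right hand side, that is, an average of \<open>g\<close> over a small ball. Hence upper and lower
  bounds on \<open>g\<close> in \<open>ball x e\<close> pass to it.\<close>

lemma weak_poisson_approximation:
  fixes u g :: "'a::euclidean_space \<Rightarrow> real"
  assumes weak: "weak_poisson \<Omega> u g" and K: "compact K" "K \<subseteq> \<Omega>" and "e > 0"
  obtains U D H where "C2_derivatives U D H" "\<And>i. i \<in> Basis \<Longrightarrow> continuous_on UNIV (D i)"
    "\<And>x. x \<in> K \<Longrightarrow> \<bar>U x - u x\<bar> \<le> e"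
    "\<And>x c. x \<in> K \<Longrightarrow> (\<And>y. y \<in> ball x e \<Longrightarrow> y \<in> \<Omega> \<Longrightarrow> c \<le> g y) \<Longrightarrow> c \<le> (\<Sum>i\<in>Basis. H i x)"
    "\<And>x c. x \<in> K \<Longrightarrow> (\<And>y. y \<in> ball x e \<Longrightarrow> y \<in> \<Omega> \<Longrightarrow> g y \<le> c) \<Longrightarrow> (\<Sum>i\<in>Basis. H i x) \<le> c"
proof -
  have "open \<Omega>" and cont: "continuous_on \<Omega> u" and int: "set_integrable lebesgue \<Omega> u"
    "set_integrable lebesgue \<Omega> g"
    and eq: "\<And>\<phi>. test_function \<Omega> \<phi> \<Longrightarrow>
      (LINT x:\<Omega>|lebesgue. u x * laplacian \<phi> x) = (LINT x:\<Omega>|lebesgue. g x * \<phi> x)"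
    using weak unfolding weak_poisson_def by blast+
  obtain d1 where "d1 > 0" and d1: "(\<Union>x\<in>K. cball x d1) \<subseteq> \<Omega>"
    using compact_subset_open_imp_cball_epsilon_subset[OF K(1) \<open>open \<Omega>\<close> K(2)] by blast
  have "uniformly_continuous_on (\<Union>x\<in>K. cball x d1) u"
    using compact_minkowski_sum_cball[OF K(1)] continuous_on_subset[OF cont d1]
    by (intro compact_uniformly_continuous)
  then obtain d2 where "d2 > 0" and d2: "\<forall>x\<in>(\<Union>x\<in>K. cball x d1). \<forall>y\<in>(\<Union>x\<in>K. cball x d1).
      dist y x < d2 \<longrightarrow> dist (u y) (u x) < e"
    unfolding uniformly_continuous_on_def using \<open>e > 0\<close> by blast
  define d where "d = min d1 (min d2 e)"
  have d: "d > 0" "d \<le> d1" "d \<le> d2" "d \<le> e"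
    using \<open>d1 > 0\<close> \<open>d2 > 0\<close> \<open>e > 0\<close> by (auto simp: d_def)
  have in_\<Omega>: "y \<in> \<Omega>" if "x \<in> K" "y \<in> cball x d" for x y
  proof -
    have "y \<in> cball x d1" using that(2) d(2) by simp
    with that(1) d1 show ?thesis by blast
  qed
  have near: "\<bar>u y - u x\<bar> \<le> e" if "x \<in> K" "y \<in> ball x d" for x y
  proof -
    have "x \<in> cball x d1" "y \<in> cball x d1" using that(2) d by auto
    moreover have "dist y x < d2" using that(2) d(3) by (simp add: dist_commute)
    ultimately have "dist (u y) (u x) < e" using d2 that(1) by blast
    then show ?thesis by (simp add: dist_norm)
  qed
  obtain \<rho> :: "'a \<Rightarrow> real" where smooth: "smooth_on UNIV \<rho>" and \<rho>: "\<And>x. \<rho> x \<ge> 0"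
    "\<And>x. norm x \<ge> d \<Longrightarrow> \<rho> x = 0" "(LINT x|lebesgue. \<rho> x) = 1"
    using mollifier_exists[OF d(1)] by blast
  have supp: "supported_in_ball d \<rho>" using \<rho>(2) by (simp add: supported_in_ball_def)
  define a where "a = (\<lambda>y. indicator \<Omega> y *\<^sub>R u y)"
  define b where "b = (\<lambda>y. indicator \<Omega> y *\<^sub>R g y)"
  have a: "integrable lebesgue a" and b: "integrable lebesgue b"
    using int unfolding a_def b_def set_integrable_def by auto
  have a_eq: "a y = u y" and b_eq: "b y = g y" if "y \<in> \<Omega>" for y
    using that by (simp_all add: a_def b_def)
  define U where "U = correlation a \<rho>"
  define D where "D = (\<lambda>i x. - correlation a (partial i \<rho>) x)"
  define H where "H = (\<lambda>i. correlation a (partial i (partial i \<rho>)))"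
  have C2: "C2_derivatives U D H"
    unfolding C2_derivatives_def
  proof (intro conjI ballI allI)
    fix x
    show "(U has_derivative (\<lambda>h. \<Sum>i\<in>Basis. (h \<bullet> i) * D i x)) (at x)"
      unfolding U_def D_def by (rule correlation_has_derivative[OF a smooth supp])
  next
    fix x i :: 'a assume i: "i \<in> Basis"
    have "((\<lambda>t. correlation a (partial i \<rho>) (x + t *\<^sub>R i)) has_real_derivative
        - correlation a (partial i (partial i \<rho>)) (x + 0 *\<^sub>R i)) (at 0)"
      by (rule has_derivative_along_line[where U = "correlation a (partial i \<rho>)"
          and D = "\<lambda>j x. - correlation a (partial j (partial i \<rho>)) x", OF correlation_has_derivative[OF a
            smooth_on_partial[OF smooth i] supported_in_ball_partial[OF supp]] i])
    from DERIV_minus[OF this]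
    show "((\<lambda>t. D i (x + t *\<^sub>R i)) has_real_derivative H i x) (at 0)"
      unfolding D_def H_def by simp
  qed
  have cont_D: "continuous_on UNIV (D i)" if i: "i \<in> Basis" for i
    unfolding D_def
    by (intro continuous_on_minus continuous_at_imp_continuous_on ballI has_derivative_continuous)
      (rule correlation_has_derivative[OF a smooth_on_partial[OF smooth i] supported_in_ball_partial[OF supp]])
  have close: "\<bar>U x - u x\<bar> \<le> e" if "x \<in> K" for x
  proof -
    have *: "y \<in> \<Omega>" "\<bar>u y - u x\<bar> \<le> e" if "y \<in> ball x d" for y
      using in_\<Omega>[OF \<open>x \<in> K\<close>, of y] near[OF \<open>x \<in> K\<close> that] that by auto
    have "u x - e \<le> correlation a \<rho> x"
      by (rule correlation_ge[OF a smooth_on_continuous_on[OF smooth] \<rho>]) (use * a_eq in force)+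
    moreover have "- u x - e \<le> correlation (\<lambda>y. - a y) \<rho> x"
      by (rule correlation_ge[OF integrable_minus[OF a] smooth_on_continuous_on[OF smooth] \<rho>])
        (use * a_eq in force)+
    ultimately show ?thesis by (simp add: U_def correlation_def)
  qed
  have lap: "(\<Sum>i\<in>Basis. H i x) = correlation b \<rho> x" if "x \<in> K" for x
  proof -
    have "test_function \<Omega> (\<lambda>y. \<rho> (y - x))"
    proof -
      have "{y. \<rho> (y - x) \<noteq> 0} \<subseteq> cball x d"
        using \<rho>(2) by (force simp: dist_norm norm_minus_commute)
      then have cl: "closure {y. \<rho> (y - x) \<noteq> 0} \<subseteq> cball x d"
        by (intro closure_minimal) auto
      then have "bounded (closure {y. \<rho> (y - x) \<noteq> 0})" by (rule bounded_subset[rotated]) simp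
      then show ?thesis
        using cl in_\<Omega>[OF that] smooth_on_translate[OF smooth, of x]
        by (auto simp: test_function_def compact_eq_bounded_closed)
    qed
    from eq[OF this]
    have "(LINT y:\<Omega>|lebesgue. u y * (\<Sum>i\<in>Basis. partial i (partial i \<rho>) (y - x))) =
        (LINT y:\<Omega>|lebesgue. g y * \<rho> (y - x))"
      by (simp only: laplacian_translate[OF smooth])
    then have "(LINT y|lebesgue. (\<Sum>i\<in>Basis. a y * partial i (partial i \<rho>) (y - x))) = correlation b \<rho> x"
      by (simp add: set_lebesgue_integral_def a_def b_def correlation_def sum_distrib_left mult_ac)
    moreover have "(LINT y|lebesgue. (\<Sum>i\<in>Basis. a y * partial i (partial i \<rho>) (y - x))) =
        (\<Sum>i\<in>Basis. H i x)"
      unfolding H_def correlation_def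
    proof (rule Bochner_Integration.integral_sum)
      fix i :: 'a assume i: "i \<in> Basis"
      show "integrable lebesgue (\<lambda>y. a y * partial i (partial i \<rho>) (y - x))"
        using smooth_on_continuous_on[OF smooth_on_partial[OF smooth_on_partial[OF smooth i] i]]
          supported_in_ball_partial[OF supported_in_ball_partial[OF supp]]
        by (rule integrable_correlation[OF a])
    qed
    ultimately show ?thesis by simp
  qed
  have lap_ge: "c \<le> (\<Sum>i\<in>Basis. H i x)"
    if "x \<in> K" "\<And>y. y \<in> ball x e \<Longrightarrow> y \<in> \<Omega> \<Longrightarrow> c \<le> g y" for x c
    unfolding lap[OF that(1)]
  proof (rule correlation_ge[OF b smooth_on_continuous_on[OF smooth] \<rho>])
    fix y assume "y \<in> ball x d"
    then have "y \<in> \<Omega>" "y \<in> ball x e" using in_\<Omega>[OF that(1), of y] d(4) by auto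
    then show "c \<le> b y" using that(2) b_eq by simp
  qed
  have lap_le: "(\<Sum>i\<in>Basis. H i x) \<le> c"
    if "x \<in> K" "\<And>y. y \<in> ball x e \<Longrightarrow> y \<in> \<Omega> \<Longrightarrow> g y \<le> c" for x c
  proof -
    have "- c \<le> correlation (\<lambda>y. - b y) \<rho> x"
    proof (rule correlation_ge[OF integrable_minus[OF b] smooth_on_continuous_on[OF smooth] \<rho>])
      fix y assume "y \<in> ball x d"
      then have "y \<in> \<Omega>" "y \<in> ball x e" using in_\<Omega>[OF that(1), of y] d(4) by auto
      then show "- c \<le> - b y" using that(2) b_eq by simp
    qed
    then show ?thesis unfolding lap[OF that(1)] by (simp add: correlation_def)
  qed
  show thesis by (rule that[OF C2 cont_D close lap_ge lap_le])
qed

section \<open>Touching from above\<close>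

text \<open>Distributional subsolutions are viscosity subsolutions: a paraboloid with smaller Laplacian cannot touch
  \<open>u\<close> from above. A multiple of the squared distance to \<open>x\<close> makes the touching strict with a margin at the
  boundary of a smaller ball. If \<open>U\<close> is closer to \<open>u\<close> than half this margin, then the difference of \<open>U\<close>
  and the steeper paraboloid still has an interior maximum, which its Laplacian forbids.\<close>

lemma weak_poisson_no_touching:
  fixes u g :: "'a::euclidean_space \<Rightarrow> real" and a \<eta> :: real
  assumes weak: "weak_poisson \<Omega> u g" and r: "r > 0" "ball x r \<subseteq> \<Omega>"
    and g: "\<And>y. y \<in> ball x r \<Longrightarrow> \<eta> \<le> g y" and a: "2 * real DIM('a) * a < \<eta>"
    and max: "\<And>y. y \<in> ball x r \<Longrightarrow> u y - a * (norm (y - z))^2 \<le> u x - a * (norm (x - z))^2"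
  shows False
proof -
  \<comment> \<open>half of the gap between \<open>2 N a\<close> and \<open>\<eta>\<close> is left after steepening the paraboloid by \<open>b\<close>\<close>
  define b where "b = (\<eta> - 2 * real DIM('a) * a) / (4 * real DIM('a))"
  have "b > 0" using a by (simp add: b_def)
  have ab: "2 * real DIM('a) * (a + b) < \<eta>"
  proof -
    have "2 * real DIM('a) * b = (\<eta> - 2 * real DIM('a) * a) / 2" by (simp add: b_def)
    then show ?thesis using a by (simp add: distrib_left)
  qed
  \<comment> \<open>\<open>b * (r / 2)\<^sup>2\<close> is the margin on the sphere; an error \<open>e\<close> of \<open>U\<close> enters twice\<close>
  define e where "e = min (r / 2) (b * r^2 / 16)"
  have e: "e > 0" "e \<le> r / 2" "2 * e < b * (r / 2)^2"
    using r \<open>b > 0\<close> by (auto simp: e_def power2_eq_square min_def)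
  let ?K = "cball x (r / 2)"
  have K: "compact ?K" "?K \<subseteq> \<Omega>" using r by (auto intro: subset_trans[OF _ r(2)])
  obtain U D H where C2: "C2_derivatives U D H" and U: "\<And>y. y \<in> ?K \<Longrightarrow> \<bar>U y - u y\<bar> \<le> e"
    and H: "\<And>y c. y \<in> ?K \<Longrightarrow> (\<And>w. w \<in> ball y e \<Longrightarrow> w \<in> \<Omega> \<Longrightarrow> c \<le> g w) \<Longrightarrow> c \<le> (\<Sum>i\<in>Basis. H i y)"
    by (rule weak_poisson_approximation[OF weak K e(1)]) blast
  define W where "W = (\<lambda>y. U y + (- a) * (norm (y - z))^2 + (- b) * (norm (y - x))^2)"
  have W: "C2_derivatives W (\<lambda>i y. D i y + (- a) * (2 * ((y - z) \<bullet> i)) + (- b) * (2 * ((y - x) \<bullet> i)))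
      (\<lambda>i y. H i y + (- a) * 2 + (- b) * 2)"
    unfolding W_def
    by (intro C2_derivatives_add C2_derivatives_cmult C2_derivatives_square_dist C2)
  obtain y where y: "y \<in> ?K" and y_max: "\<And>w. w \<in> ?K \<Longrightarrow> W w \<le> W y"
    using continuous_attains_sup[OF K(1) _ C2_derivatives_continuous[OF W]] r by fastforce
  have "norm (y - x) < r / 2"
  proof (rule ccontr)
    assume "\<not> norm (y - x) < r / 2"
    then have "norm (y - x) = r / 2" using y by (simp add: dist_norm norm_minus_commute)
    then have "W y = U y - a * (norm (y - z))^2 - b * (r / 2)^2" by (simp only: W_def)
    also have "\<dots> \<le> e + (u y - a * (norm (y - z))^2) - b * (r / 2)^2"
      using U[OF y] by linarith
    also have "\<dots> \<le> e + (u x - a * (norm (x - z))^2) - b * (r / 2)^2"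
      using max[of y] y r by auto
    also have "\<dots> < u x - e - a * (norm (x - z))^2" using e(3) by linarith
    also have "\<dots> \<le> W x" using U[of x] r by (simp add: W_def)
    also have "\<dots> \<le> W y" using y_max r by simp
    finally show False by simp
  qed
  moreover have "w \<in> ?K" if "w \<in> ball y (r / 2 - norm (y - x))" for w
    using that dist_triangle[of x w y] by (simp add: dist_norm norm_minus_commute)
  ultimately have "H i y + (- a) * 2 + (- b) * 2 \<le> 0" if "i \<in> Basis" for i
    using C2_derivatives_local_max[OF W that, of "r / 2 - norm (y - x)" y] y_max by simp
  then have "(\<Sum>i\<in>Basis. H i y) \<le> (\<Sum>i\<in>(Basis::'a set). 2 * (a + b))"
    by (intro sum_mono) fastforce
  moreover have "\<eta> \<le> (\<Sum>i\<in>Basis. H i y)"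
  proof (rule H[OF y])
    fix w assume "w \<in> ball y e"
    then have "w \<in> ball x r"
      using y e(2) dist_triangle[of x w y] by (simp add: dist_commute)
    then show "\<eta> \<le> g w" by (rule g)
  qed
  ultimately show False using ab by (simp add: algebra_simps)
qed

section \<open>The interior gradient estimate\<close>

text \<open>Reflection in the hyperplane through \<open>z\<close> orthogonal to the unit vector \<open>i\<close>.\<close>

definition reflect :: "'a::euclidean_space \<Rightarrow> 'a \<Rightarrow> 'a \<Rightarrow> 'a" where
  "reflect i z x = x - (2 * ((x - z) \<bullet> i)) *\<^sub>R i"

lemma norm_reflect:
  assumes "i \<in> Basis"
  shows "norm (reflect i z x - z) = norm (x - z)"
proof -
  have "(norm (reflect i z x - z))^2 = (norm (x - z))^2"
    unfolding power2_norm_eq_inner reflect_def using assms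
    by (simp add: inner_diff_left inner_diff_right inner_commute algebra_simps)
  then show ?thesis by simp
qed

lemma C2_derivatives_reflect:
  fixes U :: "'a::euclidean_space \<Rightarrow> real"
  assumes C2: "C2_derivatives U D H" and i: "i \<in> Basis"
  shows "C2_derivatives (\<lambda>x. U (reflect i z x))
    (\<lambda>j x. (if j = i then -1 else 1) * D j (reflect i z x)) (\<lambda>j x. H j (reflect i z x))"
  unfolding C2_derivatives_def
proof (intro conjI allI ballI)
  fix x
  have "(reflect i z has_derivative (\<lambda>h. h - (2 * (h \<bullet> i)) *\<^sub>R i)) (at x)"
    unfolding reflect_def by (auto intro!: derivative_eq_intros)
  from has_derivative_compose[OF this, of U] C2
  have "((\<lambda>x. U (reflect i z x)) has_derivative
      (\<lambda>h. \<Sum>j\<in>Basis. ((h - (2 * (h \<bullet> i)) *\<^sub>R i) \<bullet> j) * D j (reflect i z x))) (at x)"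
    unfolding C2_derivatives_def by blast
  moreover have "((h - (2 * (h \<bullet> i)) *\<^sub>R i) \<bullet> j) * D j (reflect i z x) =
      (h \<bullet> j) * ((if j = i then -1 else 1) * D j (reflect i z x))" if "j \<in> Basis" for h j
    using that i by (auto simp: inner_diff_left inner_Basis)
  ultimately show "((\<lambda>x. U (reflect i z x)) has_derivative
      (\<lambda>h. \<Sum>j\<in>Basis. (h \<bullet> j) * ((if j = i then -1 else 1) * D j (reflect i z x)))) (at x)"
    by (simp cong: sum.cong)
next
  fix x j :: 'a assume j: "j \<in> Basis"
  define s :: real where "s = (if j = i then -1 else 1)"
  have line: "reflect i z (x + t *\<^sub>R j) = reflect i z x + (s * t) *\<^sub>R j" for t
    using i j by (auto simp: reflect_def s_def inner_add_left inner_diff_left inner_Basis algebra_simps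
        simp flip: scaleR_add_left)
  have "((\<lambda>t. D j (reflect i z x + t *\<^sub>R j)) has_real_derivative H j (reflect i z x)) (at (s * 0))"
    using C2 j by (simp add: C2_derivatives_def)
  from DERIV_cmult[OF DERIV_chain'[OF DERIV_cmult_Id this], of s]
  have "((\<lambda>t. s * D j (reflect i z (x + t *\<^sub>R j))) has_real_derivative
      s * (H j (reflect i z x) * s)) (at 0)"
    by (simp only: line)
  moreover have "s * (H j (reflect i z x) * s) = H j (reflect i z x)" by (simp add: s_def)
  ultimately show "((\<lambda>t. (if j = i then -1 else 1) * D j (reflect i z (x + t *\<^sub>R j))) has_real_derivative
      H j (reflect i z x)) (at 0)"
    by (simp only: s_def)
qed

text \<open>The odd part \<open>(U x - U (reflect i z x)) / 2\<close> vanishes on the hyperplane through \<open>z\<close>, is bounded by \<open>M\<close>, and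
  its Laplacian is at least \<open>- G\<close>. With \<open>s\<close> the \<open>i\<close>-th coordinate of \<open>x - z\<close>, the barrier
  \<open>A \<bar>x - z\<bar>\<^sup>2 + C s (d - s)\<close> has Laplacian \<open>2 N A - 2 C = - G' < - G\<close>. It is nonnegative on the flat part of the
  boundary of the half ball \<open>s \<ge> 0\<close> and at least \<open>M\<close> on the spherical part, so it dominates the odd part in
  the half ball. As both vanish at \<open>z\<close>, the derivative of the odd part there, which is \<open>D i z\<close>, is at most the
  slope \<open>C d\<close> of the barrier.\<close>

lemma C2_gradient_upper_bound:
  fixes U :: "'a::euclidean_space \<Rightarrow> real" and M G G' :: real
  assumes C2: "C2_derivatives U D H" and i: "i \<in> Basis" and "d > 0"
    and M: "\<And>x. x \<in> cball z d \<Longrightarrow> \<bar>U x\<bar> \<le> M"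
    and G: "\<And>x. x \<in> cball z d \<Longrightarrow> \<bar>\<Sum>j\<in>Basis. H j x\<bar> \<le> G"
    and "G < G'"
  shows "D i z \<le> DIM('a) * M / d + G' * d / 2"
proof -
  have "M \<ge> 0" using M[of z] \<open>d > 0\<close> by (simp add: order_trans[OF abs_ge_zero])
  have "G \<ge> 0" using G[of z] \<open>d > 0\<close> by (simp add: order_trans[OF abs_ge_zero])
  define A where "A = M / d^2"
  define C where "C = DIM('a) * A + G' / 2"
  have "A \<ge> 0" using \<open>M \<ge> 0\<close> by (simp add: A_def)
  have "C \<ge> 0" using \<open>A \<ge> 0\<close> \<open>G \<ge> 0\<close> \<open>G < G'\<close> by (simp add: C_def)
  let ?R = "reflect i z"
  let ?s = "\<lambda>x. (x - z) \<bullet> i"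
  define W where "W = (\<lambda>x. 1/2 * U x + (-1/2) * U (?R x) + (- A) * (norm (x - z))^2 +
      (- C * d) * ?s x + C * (?s x)^2)"
  obtain E where W: "C2_derivatives W E (\<lambda>j x. 1/2 * H j x + (-1/2) * H j (?R x) + (- A) * 2 +
      (- C * d) * 0 + C * (if j = i then 2 else 0))"
    using C2_derivatives_add[OF C2_derivatives_add[OF C2_derivatives_add[OF C2_derivatives_add[OF
        C2_derivatives_cmult[OF C2, of "1/2"]
        C2_derivatives_cmult[OF C2_derivatives_reflect[OF C2 i, of z], of "-1/2"]]
        C2_derivatives_cmult[OF C2_derivatives_square_dist[of z], of "- A"]]
        C2_derivatives_cmult[OF C2_derivatives_coordinate[OF i, of z], of "- C * d"]]
        C2_derivatives_cmult[OF C2_derivatives_coordinate_square[OF i, of z], of C]]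
    unfolding W_def by blast
  have R_in: "?R x \<in> cball z d" if "x \<in> cball z d" for x
    using that norm_reflect[OF i, of z x] by (simp add: dist_norm norm_minus_commute)
  define Q where "Q = cball z d \<inter> {x. 0 \<le> ?s x}"
  have "closed {x. 0 \<le> ?s x}"
    by (intro closed_Collect_le continuous_intros)
  then have "compact Q" unfolding Q_def by (intro compact_Int_closed) auto
  moreover have "z \<in> Q" using \<open>d > 0\<close> by (simp add: Q_def)
  ultimately obtain y where y: "y \<in> Q" and y_max: "\<And>x. x \<in> Q \<Longrightarrow> W x \<le> W y"
    using continuous_attains_sup[of Q W] C2_derivatives_continuous[OF W] by blast
  have y': "norm (y - z) \<le> d" "0 \<le> ?s y" "?s y \<le> d"
    using y Basis_le_norm[OF i, of "y - z"] by (auto simp: Q_def dist_norm norm_minus_commute)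
  have "W y \<le> 0"
  proof -
    consider "?s y = 0" | "norm (y - z) = d" | "?s y > 0" "norm (y - z) < d"
      using y' by linarith
    then show ?thesis
    proof cases
      case 1
      then have "?R y = y" by (simp add: reflect_def)
      then show ?thesis using 1 \<open>A \<ge> 0\<close> by (simp add: W_def)
    next
      case 2
      have "\<bar>U y\<bar> \<le> M" "\<bar>U (?R y)\<bar> \<le> M" using M R_in y by (auto simp: Q_def)
      moreover have "A * (norm (y - z))^2 = M" using 2 \<open>d > 0\<close> by (simp add: A_def)
      moreover have "0 \<le> C * (?s y * (d - ?s y))" using y' \<open>C \<ge> 0\<close> by simp
      ultimately show ?thesis unfolding W_def
        by (simp add: power2_eq_square right_diff_distrib mult_ac)
    next
      case 3
      define r where "r = min (?s y) (d - norm (y - z))"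
      have "x \<in> Q" if "x \<in> ball y r" for x
      proof -
        have x: "norm (x - y) < r" using that by (simp add: dist_norm norm_minus_commute)
        have "norm (x - z) \<le> norm (x - y) + norm (y - z)" using norm_triangle_ineq[of "x - y" "y - z"] by simp
        then have "norm (x - z) \<le> d" using x by (simp add: r_def)
        moreover have "\<bar>(x - y) \<bullet> i\<bar> < ?s y" using Basis_le_norm[OF i, of "x - y"] x by (simp add: r_def)
        then have "?s x \<ge> 0" by (simp add: inner_diff_left)
        ultimately show ?thesis by (simp add: Q_def dist_norm norm_minus_commute)
      qed
      moreover have "r > 0" using 3 by (simp add: r_def)
      ultimately have "1/2 * H j y + (-1/2) * H j (?R y) + (- A) * 2 +
          (- C * d) * 0 + C * (if j = i then 2 else 0) \<le> 0" if "j \<in> Basis" for j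
        using C2_derivatives_local_max[OF W that, of r y] y_max by blast
      then have "(\<Sum>j\<in>Basis. 1/2 * H j y + (-1/2) * H j (?R y) + (- A) * 2 +
          (- C * d) * 0 + C * (if j = i then 2 else 0)) \<le> 0"
        by (rule sum_nonpos)
      moreover have "(\<Sum>j\<in>Basis. C * (if j = i then 2 else 0)) = 2 * C"
        using i by (simp add: if_distrib cong: if_cong)
      ultimately have "1/2 * (\<Sum>j\<in>Basis. H j y) - 1/2 * (\<Sum>j\<in>Basis. H j (?R y)) - 2 * real DIM('a) * A
          + 2 * C \<le> 0"
        by (simp add: sum.distrib sum_subtractf sum_divide_distrib[symmetric] mult_ac)
      moreover have "\<bar>\<Sum>j\<in>Basis. H j y\<bar> \<le> G" "\<bar>\<Sum>j\<in>Basis. H j (?R y)\<bar> \<le> G"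
        using G R_in y by (auto simp: Q_def)
      moreover have "2 * C = 2 * real DIM('a) * A + G'" by (simp add: C_def)
      ultimately show ?thesis using \<open>G < G'\<close> by linarith
    qed
  qed
  \<comment> \<open>odd part minus barrier on the normal line through \<open>z\<close>, without the favourable term \<open>C * t\<^sup>2\<close>\<close>
  define p where "p = (\<lambda>t. 1/2 * U (z + t *\<^sub>R i) + (-1/2) * U (z + (- t) *\<^sub>R i) - (C * d * t + A * t^2))"
  have p_le: "p t \<le> 0" if "0 \<le> t" "t \<le> d" for t
  proof -
    have "z + t *\<^sub>R i \<in> Q" using that i by (simp add: Q_def dist_norm)
    then have "W (z + t *\<^sub>R i) \<le> 0" using y_max \<open>W y \<le> 0\<close> by fastforce
    moreover have "?R (z + t *\<^sub>R i) = z + (- t) *\<^sub>R i"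
      using i by (simp add: reflect_def algebra_simps flip: scaleR_add_left)
    moreover have "0 \<le> C * t^2" using \<open>C \<ge> 0\<close> by simp
    ultimately show ?thesis using i by (simp add: W_def p_def)
  qed
  have "(p has_real_derivative D i z - C * d) (at 0)"
  proof -
    have 1: "((\<lambda>t. U (z + t *\<^sub>R i)) has_real_derivative D i z) (at (- 0))"
      and 2: "((\<lambda>t. U (z + t *\<^sub>R i)) has_real_derivative D i z) (at 0)"
      using C2_derivatives_line(1)[OF C2 i, of z 0] by simp_all
    have "((\<lambda>t. U (z + (- t) *\<^sub>R i)) has_real_derivative D i z * - 1) (at 0)"
      by (rule DERIV_chain'[where f = "\<lambda>t. - t" and x = 0 and s = UNIV, OF _ 1]) (auto intro!: derivative_eq_intros)
    then show ?thesis unfolding p_def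
      by (auto intro!: derivative_eq_intros 2 simp: algebra_simps)
  qed
  have "D i z \<le> C * d"
  proof (rule ccontr)
    assume "\<not> D i z \<le> C * d"
    then have "D i z - C * d > 0" by simp
    from DERIV_pos_inc_right[OF \<open>(p has_real_derivative D i z - C * d) (at 0)\<close> this]
    obtain e where "e > 0" and e: "\<And>h. 0 < h \<Longrightarrow> h < e \<Longrightarrow> p 0 < p h" by auto
    define s where "s = min (e / 2) d"
    have s: "0 < s" "s < e" "s \<le> d" using \<open>e > 0\<close> \<open>d > 0\<close> by (auto simp: s_def)
    have "p 0 = 0" by (simp add: p_def)
    with e[OF s(1,2)] p_le[of s] s show False by simp
  qed
  also have "C * d = DIM('a) * M / d + G' * d / 2"
    using \<open>d > 0\<close> by (simp add: C_def A_def field_simps power2_eq_square)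
  finally show ?thesis .
qed

lemma C2_gradient_bound:
  fixes U :: "'a::euclidean_space \<Rightarrow> real" and M G :: real
  assumes C2: "C2_derivatives U D H" and i: "i \<in> Basis" and "d > 0"
    and M: "\<And>x. x \<in> cball z d \<Longrightarrow> \<bar>U x\<bar> \<le> M"
    and G: "\<And>x. x \<in> cball z d \<Longrightarrow> \<bar>\<Sum>j\<in>Basis. H j x\<bar> \<le> G"
  shows "\<bar>D i z\<bar> \<le> DIM('a) * M / d + G * d / 2"
proof (rule field_le_epsilon)
  fix e :: real assume "e > 0"
  \<comment> \<open>the strict bound above needs \<open>G < G'\<close>; the excess costs exactly \<open>e\<close>\<close>
  define G' where "G' = G + 2 * e / d"
  have "G < G'" using \<open>e > 0\<close> \<open>d > 0\<close> by (simp add: G'_def)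
  have "D i z \<le> DIM('a) * M / d + G' * d / 2"
    by (rule C2_gradient_upper_bound[OF C2 i \<open>d > 0\<close> M G \<open>G < G'\<close>])
  moreover have "-1 * D i z \<le> DIM('a) * M / d + G' * d / 2"
    by (rule C2_gradient_upper_bound[OF C2_derivatives_cmult[OF C2, of "-1"] i \<open>d > 0\<close> _ _ \<open>G < G'\<close>])
      (use M G in \<open>simp_all add: sum_negf\<close>)
  moreover have "G' * d / 2 = G * d / 2 + e"
    using \<open>d > 0\<close> by (simp add: G'_def field_simps)
  ultimately show "\<bar>D i z\<bar> \<le> DIM('a) * M / d + G * d / 2 + e" by linarith
qed

text \<open>On an open set where \<open>g\<close> is bounded, weak solutions are \<open>C\<^sup>1\<close>, and their gradient obeys the same interior
  estimate as that of \<open>C\<^sup>2\<close> functions. The approximations \<open>U n\<close> converge uniformly, and the estimate bounds the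
  difference of two of their gradients by \<open>N (e n + e m) / d + G d\<close> for every radius \<open>d \<le> r\<close>. Choosing \<open>d\<close>
  first makes the gradients uniformly Cauchy, although the Laplacians of the \<open>U n\<close> need not converge.\<close>

lemma weak_poisson_gradient:
  fixes u g :: "'a::euclidean_space \<Rightarrow> real" and c G M :: real
  assumes weak: "weak_poisson \<Omega> u g" and r: "r > 0" "cball z (3 * r) \<subseteq> \<Omega>"
    and G: "\<And>y. y \<in> cball z (3 * r) \<Longrightarrow> \<bar>g y\<bar> \<le> G"
    and M: "\<And>y. y \<in> cball z (3 * r) \<Longrightarrow> \<bar>u y - c\<bar> \<le> M"
  shows "\<And>x. x \<in> ball z r \<Longrightarrow> u differentiable (at x)"
    and "\<And>i. i \<in> Basis \<Longrightarrow> continuous_on (ball z r) (partial i u)"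
    and "\<And>i. i \<in> Basis \<Longrightarrow> \<bar>partial i u z\<bar> \<le> DIM('a) * M / r + G * r / 2"
proof -
  let ?K = "cball z (2 * r)"
  have K: "compact ?K" "?K \<subseteq> \<Omega>" using r by (auto intro: subset_trans[OF _ r(2)])
  define e where "e n = min r (inverse (real (Suc n)))" for n
  have e: "e n > 0" "e n \<le> r" for n using r by (auto simp: e_def)
  have e_lim: "e \<longlonglongrightarrow> 0"
  proof (rule tendsto_sandwich[OF _ _ tendsto_const LIMSEQ_inverse_real_of_nat])
    show "\<forall>\<^sub>F n in sequentially. 0 \<le> e n" using e(1) by (simp add: less_imp_le)
    show "\<forall>\<^sub>F n in sequentially. e n \<le> inverse (real (Suc n))" by (simp add: e_def)
  qed
  define approx where "approx n T \<longleftrightarrow> (case T of (U, D, H) \<Rightarrow>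
      C2_derivatives U D H \<and> (\<forall>i\<in>Basis. continuous_on UNIV (D i)) \<and>
      (\<forall>x\<in>?K. \<bar>U x - u x\<bar> \<le> e n) \<and> (\<forall>x\<in>?K. \<bar>\<Sum>i\<in>Basis. H i x\<bar> \<le> G))" for n T
  have "\<exists>T. approx n T" for n
  proof -
    obtain U D H where *: "C2_derivatives U D H" "\<And>i. i \<in> Basis \<Longrightarrow> continuous_on UNIV (D i)"
      "\<And>x. x \<in> ?K \<Longrightarrow> \<bar>U x - u x\<bar> \<le> e n" and
      ge: "\<And>x c. x \<in> ?K \<Longrightarrow> (\<And>y. y \<in> ball x (e n) \<Longrightarrow> y \<in> \<Omega> \<Longrightarrow> c \<le> g y) \<Longrightarrow> c \<le> (\<Sum>i\<in>Basis. H i x)" and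
      le: "\<And>x c. x \<in> ?K \<Longrightarrow> (\<And>y. y \<in> ball x (e n) \<Longrightarrow> y \<in> \<Omega> \<Longrightarrow> g y \<le> c) \<Longrightarrow> (\<Sum>i\<in>Basis. H i x) \<le> c"
      by (rule weak_poisson_approximation[OF weak K e(1)]) blast
    have "\<bar>\<Sum>i\<in>Basis. H i x\<bar> \<le> G" if "x \<in> ?K" for x
    proof -
      have "\<bar>g y\<bar> \<le> G" if "y \<in> ball x (e n)" for y
        using that \<open>x \<in> ?K\<close> e(2)[of n] dist_triangle[of z y x] by (intro G) (simp add: dist_commute)
      then have "- G \<le> (\<Sum>i\<in>Basis. H i x)" "(\<Sum>i\<in>Basis. H i x) \<le> G"
        by (intro ge le that; fastforce simp: abs_le_iff)+
      then show ?thesis by simp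
    qed
    then have "approx n (U, D, H)" using * unfolding approx_def by simp
    then show ?thesis ..
  qed
  then obtain T where T: "\<And>n. approx n (T n)" by metis
  define U where "U n = fst (T n)" for n
  define D where "D n = fst (snd (T n))" for n
  define H where "H n = snd (snd (T n))" for n
  have "approx n (U n, D n, H n)" for n using T by (simp add: U_def D_def H_def)
  then have C2: "C2_derivatives (U n) (D n) (H n)"
    and cont_D: "i \<in> Basis \<Longrightarrow> continuous_on UNIV (D n i)"
    and close: "x \<in> ?K \<Longrightarrow> \<bar>U n x - u x\<bar> \<le> e n"
    and lap: "x \<in> ?K \<Longrightarrow> \<bar>\<Sum>i\<in>Basis. H n i x\<bar> \<le> G" for n i x
    unfolding approx_def by auto
  have "G \<ge> 0" using G[of z] r by (simp add: order_trans[OF abs_ge_zero])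

  have D_diff: "\<bar>D n i x - D m i x\<bar> \<le> DIM('a) * (e n + e m) / d + G * d"
    if "x \<in> ball z r" "i \<in> Basis" "0 < d" "d \<le> r" for n m i x d
  proof -
    have in_K: "y \<in> ?K" if "y \<in> cball x d" for y
      using that \<open>x \<in> ball z r\<close> \<open>d \<le> r\<close> dist_triangle[of z y x] by simp
    have "\<bar>D n i x + -1 * D m i x\<bar> \<le> DIM('a) * (e n + e m) / d + (G + G) * d / 2"
    proof (rule C2_gradient_bound[OF C2_derivatives_add[OF C2[of n]
            C2_derivatives_cmult[OF C2[of m], of "-1"]] that(2,3), of x "e n + e m" "G + G"])
      fix y assume "y \<in> cball x d"
      then have "y \<in> ?K" by (rule in_K)
      then show "\<bar>U n y + -1 * U m y\<bar> \<le> e n + e m"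
        using close[of y n] close[of y m] by simp
      show "\<bar>\<Sum>j\<in>Basis. H n j y + -1 * H m j y\<bar> \<le> G + G"
        using lap[of y n] lap[of y m] \<open>y \<in> ?K\<close> by (simp add: sum_subtractf)
    qed
    then show ?thesis by (simp add: algebra_simps)
  qed
  have "uniformly_Cauchy_on (ball z r) (\<lambda>n. D n i)" if i: "i \<in> Basis" for i
    unfolding uniformly_Cauchy_on_def
  proof (intro allI impI)
    fix \<epsilon> :: real assume "\<epsilon> > 0"
    \<comment> \<open>the radius is fixed here, before \<open>N\<close>: it controls the term with \<open>G\<close>\<close>
    define d where "d = min r (\<epsilon> / (2 * (G + 1)))"
    have d: "0 < d" "d \<le> r" using \<open>\<epsilon> > 0\<close> \<open>G \<ge> 0\<close> r by (auto simp: d_def)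
    have "G * d \<le> (G + 1) * (\<epsilon> / (2 * (G + 1)))"
      using \<open>G \<ge> 0\<close> d by (intro mult_mono) (auto simp: d_def)
    also have "\<dots> = \<epsilon> / 2" using \<open>G \<ge> 0\<close> by (simp add: field_simps)
    finally have Gd: "G * d \<le> \<epsilon> / 2" .
    have "\<forall>\<^sub>F n in sequentially. e n < \<epsilon> * d / (4 * DIM('a))"
      using e_lim \<open>\<epsilon> > 0\<close> d by (intro order_tendstoD) auto
    then obtain N where N: "\<And>n. n \<ge> N \<Longrightarrow> e n < \<epsilon> * d / (4 * DIM('a))"
      unfolding eventually_sequentially by blast
    have "dist (D m i x) (D n i x) < \<epsilon>" if "x \<in> ball z r" "m \<ge> N" "n \<ge> N" for x m n
    proof -
      have "e m + e n < \<epsilon> * d / (2 * DIM('a))" using N[OF that(2)] N[OF that(3)] by simp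
      then have "DIM('a) * (e m + e n) / d < \<epsilon> / 2" using d by (simp add: field_simps)
      with D_diff[OF that(1) i d, of m n] Gd show ?thesis
        unfolding dist_norm real_norm_def by linarith
    qed
    then show "\<exists>N. \<forall>x\<in>ball z r. \<forall>m\<ge>N. \<forall>n\<ge>N. dist (D m i x) (D n i x) < \<epsilon>" by blast
  qed
  then have "\<forall>i\<in>Basis. \<exists>v. uniform_limit (ball z r) (\<lambda>n. D n i) v sequentially"
    using Cauchy_uniformly_convergent unfolding uniformly_convergent_on_def by blast
  from bchoice[OF this] obtain v where
    v: "\<And>i. i \<in> Basis \<Longrightarrow> uniform_limit (ball z r) (\<lambda>n. D n i) (v i) sequentially"
    by blast
  have U_lim: "(\<lambda>n. U n x) \<longlonglongrightarrow> u x" if "x \<in> ball z r" for x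
  proof -
    have "norm (U n x - u x) \<le> e n" for n using close[of x n] that r by simp
    then have "(\<lambda>n. U n x - u x) \<longlonglongrightarrow> 0"
      by (intro Lim_null_comparison[OF _ e_lim]) simp
    then show ?thesis by (simp add: LIM_zero_iff)
  qed
  have "\<exists>w. \<forall>x\<in>ball z r. (\<lambda>n. U n x) \<longlonglongrightarrow> w x \<and>
      (w has_derivative (\<lambda>h. \<Sum>i\<in>Basis. (h \<bullet> i) * v i x)) (at x within ball z r)"
  proof (rule has_derivative_sequence[where ?x0.0 = z])
    show "(U n has_derivative (\<lambda>h. \<Sum>i\<in>Basis. (h \<bullet> i) * D n i x)) (at x within ball z r)" for n x
      using C2[of n] unfolding C2_derivatives_def by (blast intro: has_derivative_at_withinI)
    fix \<epsilon> :: real assume "\<epsilon> > 0"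
    have "\<forall>\<^sub>F n in sequentially. \<forall>i\<in>Basis. \<forall>x\<in>ball z r. dist (D n i x) (v i x) < \<epsilon> / DIM('a)"
      using v \<open>\<epsilon> > 0\<close> by (intro eventually_ball_finite ballI uniform_limitD) auto
    then show "\<forall>\<^sub>F n in sequentially. \<forall>x\<in>ball z r. \<forall>h.
        norm ((\<Sum>i\<in>Basis. (h \<bullet> i) * D n i x) - (\<Sum>i\<in>Basis. (h \<bullet> i) * v i x)) \<le> \<epsilon> * norm h"
    proof (rule eventually_mono, intro ballI allI)
      fix n x h
      assume *: "\<forall>i\<in>Basis. \<forall>x\<in>ball z r. dist (D n i x) (v i x) < \<epsilon> / DIM('a)" and x: "x \<in> ball z r"
      have "norm ((\<Sum>i\<in>Basis. (h \<bullet> i) * D n i x) - (\<Sum>i\<in>Basis. (h \<bullet> i) * v i x)) =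
          norm (\<Sum>i\<in>Basis. (h \<bullet> i) * (D n i x - v i x))"
        by (simp add: right_diff_distrib sum_subtractf)
      also have "\<dots> \<le> (\<Sum>i\<in>(Basis::'a set). norm h * (\<epsilon> / DIM('a)))"
      proof (rule sum_norm_le)
        fix i :: 'a assume i: "i \<in> Basis"
        have "\<bar>D n i x - v i x\<bar> < \<epsilon> / DIM('a)" using * i x by (simp add: dist_norm)
        then show "norm ((h \<bullet> i) * (D n i x - v i x)) \<le> norm h * (\<epsilon> / DIM('a))"
          unfolding real_norm_def abs_mult using Basis_le_norm[OF i, of h] by (intro mult_mono) auto
      qed
      also have "\<dots> = \<epsilon> * norm h" by simp
      finally show "norm ((\<Sum>i\<in>Basis. (h \<bullet> i) * D n i x) - (\<Sum>i\<in>Basis. (h \<bullet> i) * v i x)) \<le> \<epsilon> * norm h" .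
    qed
  qed (use r U_lim[of z] in auto)
  then obtain w where w: "\<And>x. x \<in> ball z r \<Longrightarrow> (\<lambda>n. U n x) \<longlonglongrightarrow> w x"
    and w': "\<And>x. x \<in> ball z r \<Longrightarrow>
      (w has_derivative (\<lambda>h. \<Sum>i\<in>Basis. (h \<bullet> i) * v i x)) (at x within ball z r)"
    by blast
  have w_eq: "w x = u x" if "x \<in> ball z r" for x
    using LIMSEQ_unique[OF w[OF that] U_lim[OF that]] .
  have u': "(u has_derivative (\<lambda>h. \<Sum>i\<in>Basis. (h \<bullet> i) * v i x)) (at x)" if "x \<in> ball z r" for x
  proof -
    have "(w has_derivative (\<lambda>h. \<Sum>i\<in>Basis. (h \<bullet> i) * v i x)) (at x)"
      using w'[OF that] that at_within_open[OF that] by simp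
    then show ?thesis
      by (rule has_derivative_transform_within_open[OF _ open_ball that w_eq])
  qed
  then show "u differentiable (at x)" if "x \<in> ball z r" for x
    using that unfolding differentiable_def by blast
  have partial_eq: "partial i u x = v i x" if i: "i \<in> Basis" and x: "x \<in> ball z r" for i x
  proof -
    have "partial i u x = (\<Sum>j\<in>Basis. (i \<bullet> j) * v j x)" by (rule partial_eqI[OF u'[OF x]])
    also have "\<dots> = (\<Sum>j\<in>Basis. if j = i then v i x else 0)"
      using i by (intro sum.cong) (auto simp: inner_Basis)
    finally show ?thesis using i by simp
  qed
  show "continuous_on (ball z r) (partial i u)" if i: "i \<in> Basis" for i
  proof -
    have "continuous_on (ball z r) (v i)"
      by (rule uniform_limit_theorem[OF _ v[OF i]])
        (auto intro: always_eventually continuous_on_subset[OF cont_D[OF i]])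
    then show ?thesis by (rule continuous_on_eq) (simp add: partial_eq[OF i])
  qed
  show "\<bar>partial i u z\<bar> \<le> DIM('a) * M / r + G * r / 2" if i: "i \<in> Basis" for i
  proof -
    have z: "z \<in> ball z r" using r by simp
    have "\<bar>D n i z\<bar> \<le> DIM('a) * (M + e n) / r + G * r / 2" for n
    proof -
      have "\<bar>D n i z + 0\<bar> \<le> DIM('a) * (M + e n) / r + G * r / 2"
      proof (rule C2_gradient_bound[OF C2_derivatives_add[OF C2 C2_derivatives_const[of "- c"]] i r(1)])
        fix y assume "y \<in> cball z r"
        then have "y \<in> ?K" "y \<in> cball z (3 * r)" using r by auto
        then show "\<bar>U n y + - c\<bar> \<le> M + e n" "\<bar>\<Sum>j\<in>Basis. H n j y + 0\<bar> \<le> G"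
          using close[of y n] M[of y] lap[of y n] by auto
      qed
      then show ?thesis by simp
    qed
    moreover have "(\<lambda>n. \<bar>D n i z\<bar>) \<longlonglongrightarrow> \<bar>v i z\<bar>"
      by (intro tendsto_rabs tendsto_uniform_limitI[OF v[OF i] z])
    moreover have "(\<lambda>n. DIM('a) * (M + e n) / r + G * r / 2) \<longlonglongrightarrow> DIM('a) * (M + 0) / r + G * r / 2"
      using r by (intro tendsto_intros e_lim) auto
    ultimately have "\<bar>v i z\<bar> \<le> DIM('a) * (M + 0) / r + G * r / 2"
      by (intro LIMSEQ_le[of "\<lambda>n. \<bar>D n i z\<bar>"]) auto
    then show ?thesis using partial_eq[OF i z] by simp
  qed
qed

section \<open>Comparison principles for weak solutions\<close>

lemma weak_poisson_uminus:
  assumes "weak_poisson \<Omega> u g"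
  shows "weak_poisson \<Omega> (\<lambda>x. - u x) (\<lambda>x. - g x)"
  using assms unfolding weak_poisson_def set_integrable_def set_lebesgue_integral_def
  by (auto intro: continuous_on_minus)

text \<open>The bound on \<open>g\<close> is only asked for where \<open>u > s\<close>: the maximum point of \<open>u\<close> plus a small paraboloid lies in
  that open set if \<open>u\<close> exceeds \<open>s\<close> anywhere.\<close>

lemma weak_maximum_principle:
  fixes u g :: "'a::euclidean_space \<Rightarrow> real"
  assumes weak: "weak_poisson \<Omega> u g" and "bounded \<Omega>" and cont: "continuous_on (closure \<Omega>) u"
    and boundary: "\<And>x. x \<in> frontier \<Omega> \<Longrightarrow> u x \<le> s"
    and g: "\<And>x. x \<in> \<Omega> \<Longrightarrow> s < u x \<Longrightarrow> 0 \<le> g x"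
    and x0: "x0 \<in> closure \<Omega>"
  shows "u x0 \<le> s"
proof (rule ccontr)
  assume "\<not> u x0 \<le> s"
  then have gt: "u x0 > s" by simp
  have "open \<Omega>" using weak by (simp add: weak_poisson_def)
  have compact: "compact (closure \<Omega>)" using \<open>bounded \<Omega>\<close> by simp
  then obtain R where "R > 0" and "closure \<Omega> \<subseteq> ball x0 R"
    using bounded_subset_ballD[OF compact_imp_bounded] by blast
  then have R: "norm (y - x0) \<le> R" if "y \<in> closure \<Omega>" for y
    using that by (force simp: dist_norm norm_minus_commute)
  define k where "k = (u x0 - s) / (2 * R^2)"
  have k: "k > 0" "k * R^2 = (u x0 - s) / 2"
    using gt \<open>R > 0\<close> by (auto simp: k_def)
  have "continuous_on (closure \<Omega>) (\<lambda>y. u y + k * (norm (y - x0))^2)"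
    by (intro continuous_intros cont)
  then obtain z where z: "z \<in> closure \<Omega>"
    and z_max: "\<And>y. y \<in> closure \<Omega> \<Longrightarrow> u y + k * (norm (y - x0))^2 \<le> u z + k * (norm (z - x0))^2"
    using continuous_attains_sup[OF compact] x0 by (metis (no_types, lifting) empty_iff)
  have "k * (norm (z - x0))^2 \<le> k * R^2"
    using R[OF z] k(1) by (intro mult_left_mono power_mono) auto
  then have "u z > s" using z_max[OF x0] k(2) gt by (simp add: field_simps)
  then have "z \<in> \<Omega>"
    using z boundary[of z] \<open>open \<Omega>\<close> by (force simp: frontier_def interior_open)
  have "continuous_on \<Omega> u" using cont closure_subset continuous_on_subset by blast
  then have "open {y \<in> \<Omega>. s < u y}"
    using continuous_open_preimage[OF _ \<open>open \<Omega>\<close> open_greaterThan[of s]]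
    by (simp add: vimage_def Int_def)
  moreover have "z \<in> {y \<in> \<Omega>. s < u y}" using \<open>z \<in> \<Omega>\<close> \<open>u z > s\<close> by simp
  ultimately obtain r where "r > 0" and r: "ball z r \<subseteq> {y \<in> \<Omega>. s < u y}"
    using open_contains_ball by metis
  show False
  proof (rule weak_poisson_no_touching[OF weak \<open>r > 0\<close>, where \<eta> = 0 and a = "- k" and z = x0])
    show "ball z r \<subseteq> \<Omega>" using r by blast
    show "0 \<le> g y" if "y \<in> ball z r" for y using g[of y] r that by blast
    show "2 * real DIM('a) * - k < 0" using k by simp
    show "u y - (- k) * (norm (y - x0))^2 \<le> u z - (- k) * (norm (z - x0))^2" if "y \<in> ball z r" for y
      using z_max[of y] r that closure_subset by fastforce
  qed
qed

text \<open>Choose \<open>a > 0\<close> with \<open>2 N a\<close> just below \<open>\<eta>\<close>. The maximum of \<open>u y - a \<bar>y - x\<bar>\<^sup>2\<close> over the closed ball cannot be at an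
  interior point: there \<open>u\<close> would be at least \<open>u x > s\<close>, so that \<open>g \<ge> \<eta>\<close> nearby. On the sphere the value is
  at most \<open>M - a r\<^sup>2\<close>, which must then be at least the value \<open>u x\<close> at the centre.\<close>

lemma subsolution_growth:
  fixes u g :: "'a::euclidean_space \<Rightarrow> real" and M :: real
  assumes weak: "weak_poisson \<Omega> u g" and r: "r > 0" "cball x r \<subseteq> \<Omega>"
    and s: "s < u x" and g: "\<And>y. y \<in> \<Omega> \<Longrightarrow> s < u y \<Longrightarrow> \<eta> \<le> g y"
    and M: "\<And>y. y \<in> cball x r \<Longrightarrow> u y \<le> M"
  shows "\<eta> * r^2 \<le> 2 * real DIM('a) * (M - u x)"
proof (rule ccontr)
  assume "\<not> \<eta> * r^2 \<le> 2 * real DIM('a) * (M - u x)"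
  then have "(M - u x) / r^2 < \<eta> / (2 * real DIM('a))"
    using r(1) by (simp add: field_simps)
  then obtain a where a: "(M - u x) / r^2 < a" "a < \<eta> / (2 * real DIM('a))"
    using dense by blast
  have "M - u x \<ge> 0" using M[of x] r by simp
  then have "a > 0" using a(1) by (smt (verit) divide_nonneg_nonneg zero_le_power2)
  have ar: "M - a * r^2 < u x" using a(1) r by (simp add: field_simps)
  have "open \<Omega>" and cont: "continuous_on \<Omega> u" using weak by (simp_all add: weak_poisson_def)
  have "continuous_on (cball x r) (\<lambda>y. u y - a * (norm (y - x))^2)"
    by (intro continuous_intros continuous_on_subset[OF cont r(2)])
  then obtain z where z: "z \<in> cball x r" and
    z_max: "\<And>y. y \<in> cball x r \<Longrightarrow> u y - a * (norm (y - x))^2 \<le> u z - a * (norm (z - x))^2"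
    using continuous_attains_sup[of "cball x r" "\<lambda>y. u y - a * (norm (y - x))^2"] r by fastforce
  have x_le: "u x \<le> u z - a * (norm (z - x))^2" using z_max[of x] r by simp
  have "norm (z - x) \<noteq> r"
  proof
    assume "norm (z - x) = r"
    with x_le M[OF z] ar show False by simp
  qed
  then have "z \<in> ball x r" using z by (simp add: dist_norm norm_minus_commute)
  have "0 \<le> a * (norm (z - x))^2" using \<open>a > 0\<close> by simp
  then have "s < u z" using x_le s by linarith
  have "open {y \<in> \<Omega>. s < u y}"
    using continuous_open_preimage[OF cont \<open>open \<Omega>\<close> open_greaterThan[of s]]
    by (simp add: vimage_def Int_def)
  then have "open ({y \<in> \<Omega>. s < u y} \<inter> ball x r)" by (rule open_Int) simp
  moreover have "z \<in> {y \<in> \<Omega>. s < u y} \<inter> ball x r"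
    using \<open>z \<in> ball x r\<close> \<open>s < u z\<close> z r by blast
  ultimately obtain d where "d > 0" and d: "ball z d \<subseteq> {y \<in> \<Omega>. s < u y} \<inter> ball x r"
    using open_contains_ball by metis
  show False
  proof (rule weak_poisson_no_touching[OF weak \<open>d > 0\<close>, where \<eta> = \<eta> and a = a and z = x])
    show "ball z d \<subseteq> \<Omega>" using d by blast
    show "\<eta> \<le> g y" if "y \<in> ball z d" for y using g[of y] d that by blast
    show "2 * real DIM('a) * a < \<eta>" using a(2) by (simp add: field_simps)
    show "u y - a * (norm (y - x))^2 \<le> u z - a * (norm (z - x))^2" if "y \<in> ball z d" for y
      using z_max[of y] d that by fastforce
  qed
qed

section \<open>The limit of the Dirichlet problem\<close>

text \<open>The right hand side is measurable because \<open>f\<close> is monotone, and bounded because \<open>f\<close> is evaluated at most at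
  the maximum of \<open>u\<close>.\<close>

lemma dirichlet_solution_weak_poisson:
  fixes u :: "'a::euclidean_space \<Rightarrow> real"
  assumes "open \<Omega>" "bounded \<Omega>" and f: "mono f" "\<And>t. 0 \<le> f t"
    and sol: "dirichlet_solution \<Omega> f l u"
  shows "weak_poisson \<Omega> u (\<lambda>x. - l * f (u x))"
proof -
  have cont: "continuous_on (closure \<Omega>) u" using sol by (simp add: dirichlet_solution_def)
  have compact: "compact (closure \<Omega>)" using \<open>bounded \<Omega>\<close> by simp
  have cont': "continuous_on \<Omega> u" using cont closure_subset continuous_on_subset by blast
  have \<Omega>[measurable]: "\<Omega> \<in> sets borel" using \<open>open \<Omega>\<close> by simp
  have "integrable lborel (\<lambda>x. indicator (closure \<Omega>) x *\<^sub>R u x)"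
    by (rule borel_integrable_compact[OF compact cont])
  then have "set_integrable lebesgue (closure \<Omega>) u"
    unfolding set_integrable_def
    using integrable_completion[of "\<lambda>x. indicator (closure \<Omega>) x *\<^sub>R u x" lborel] by fastforce
  then have u_int: "set_integrable lebesgue \<Omega> u"
    by (rule set_integrable_subset) (use \<Omega> closure_subset in auto)
  have "compact (u ` closure \<Omega>)" using cont compact by (rule compact_continuous_image)
  then have "bdd_above (u ` closure \<Omega>)" by (intro bounded_imp_bdd_above compact_imp_bounded)
  then obtain B where "\<forall>t\<in>u ` closure \<Omega>. t \<le> B" unfolding bdd_above_def by blast
  then have B: "u x \<le> B" if "x \<in> \<Omega>" for x using that closure_subset[of \<Omega>] by blast
  define g where "g = (\<lambda>x. - l * f (u x))"
  define a where "a = (\<lambda>x. indicator \<Omega> x *\<^sub>R u x)"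
  have [measurable]: "a \<in> borel_measurable borel"
    unfolding a_def by (rule borel_measurable_continuous_on_indicator[OF \<Omega> cont'])
  have [measurable]: "f \<in> borel_measurable borel" using f(1) by (rule borel_measurable_mono)
  have "(\<lambda>x. indicator \<Omega> x *\<^sub>R g x) = (\<lambda>x. indicator \<Omega> x *\<^sub>R (- l * f (a x)))"
    by (auto simp: g_def a_def indicator_def)
  also have "\<dots> \<in> borel_measurable borel" by measurable
  finally have g_meas: "(\<lambda>x. indicator \<Omega> x *\<^sub>R g x) \<in> borel_measurable lborel" by simp
  have "emeasure lborel \<Omega> < \<infinity>" using emeasure_bounded_finite[OF \<open>bounded \<Omega>\<close>] .
  then have "integrable lborel (\<lambda>x. indicator \<Omega> x *\<^sub>R (\<bar>l\<bar> * f B))"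
    by (intro integrable_scaleR_left integrable_real_indicator) auto
  then have "integrable lborel (\<lambda>x. indicator \<Omega> x *\<^sub>R g x)"
  proof (rule Bochner_Integration.integrable_bound[OF _ g_meas], intro AE_I2)
    fix x
    show "norm (indicator \<Omega> x *\<^sub>R g x) \<le> norm (indicator \<Omega> x *\<^sub>R (\<bar>l\<bar> * f B))"
      using f(2) monoD[OF f(1) B[of x]]
      by (auto simp: indicator_def g_def abs_mult intro!: mult_left_mono)
  qed
  then have g_int: "set_integrable lebesgue \<Omega> g"
    unfolding set_integrable_def using integrable_completion[OF g_meas] by simp
  have "(LINT x:\<Omega>|lebesgue. u x * laplacian \<phi> x) = (LINT x:\<Omega>|lebesgue. g x * \<phi> x)"
    if "test_function \<Omega> \<phi>" for \<phi>
  proof -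
    have "- (LINT x:\<Omega>|lebesgue. u x * laplacian \<phi> x) = (LINT x:\<Omega>|lebesgue. l * f (u x) * \<phi> x)"
      using sol that by (simp add: dirichlet_solution_def)
    moreover have "(LINT x:\<Omega>|lebesgue. g x * \<phi> x) = - (LINT x:\<Omega>|lebesgue. l * f (u x) * \<phi> x)"
      by (simp add: set_lebesgue_integral_def g_def)
    ultimately show ?thesis by simp
  qed
  then show ?thesis
    using \<open>open \<Omega>\<close> cont' u_int g_int by (simp add: weak_poisson_def g_def)
qed

lemma Ck_on_1_iff:
  "Ck_on 1 S g \<longleftrightarrow> (\<forall>x\<in>S. g differentiable (at x)) \<and> (\<forall>i\<in>Basis. continuous_on S (partial i g))"
  by (simp add: partial_def[abs_def])

text \<open>Either \<open>f\<close> stays below \<open>f 0\<close> on an interval to the right of \<open>t0\<close>, where it is then differentiable, or \<open>f\<close>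
  is constantly \<open>f 0\<close> between \<open>t0\<close> and \<open>0\<close>. Left continuity is stated as the closedness that is used: upper
  bounds to the left of \<open>s\<close> persist at \<open>s\<close>.\<close>

lemma left_continuous_above_threshold:
  fixes f :: "real \<Rightarrow> real"
  assumes mono: "mono f" and pos: "\<And>t. t0 < t \<Longrightarrow> 0 < f t" and "t0 < 0"
    and diff: "\<And>t. 0 < f t \<Longrightarrow> f t < f 0 \<Longrightarrow>
      (f has_real_derivative f' t) (at t within {t. 0 < f t \<and> f t < f 0})"
  obtains s1 where "t0 < s1"
    "\<And>s C. t0 < s \<Longrightarrow> s < s1 \<Longrightarrow> (\<And>s'. s' < s \<Longrightarrow> f s' \<le> C) \<Longrightarrow> f s \<le> C"
proof (cases "\<exists>t2>t0. f t2 < f 0")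
  case True
  then obtain t2 where t2: "t0 < t2" "f t2 < f 0" by blast
  show thesis
  proof (rule that[OF t2(1)])
    fix s C assume s: "t0 < s" "s < t2" and C: "\<And>s'. s' < s \<Longrightarrow> f s' \<le> C"
    let ?S = "{t. 0 < f t \<and> f t < f 0}"
    have sub: "{t0<..<t2} \<subseteq> ?S"
    proof
      fix t assume "t \<in> {t0<..<t2}"
      then have "0 < f t" "f t \<le> f t2" using pos monoD[OF mono, of t t2] by auto
      then show "t \<in> ?S" using t2(2) by simp
    qed
    then have "s \<in> ?S" using s by auto
    then have "(f has_real_derivative f' s) (at s within ?S)" using diff[of s] by simp
    then have "(f has_real_derivative f' s) (at s within {t0<..<t2})"
      by (rule has_field_derivative_subset) (rule sub)
    then have "(f has_real_derivative f' s) (at s)"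
      using s at_within_open[of s "{t0<..<t2}"] by simp
    then have "isCont f s" by (rule DERIV_isCont)
    then have "(f \<longlongrightarrow> f s) (at_left s)"
      by (simp add: isCont_def filterlim_at_split)
    then show "f s \<le> C"
      by (rule tendsto_upperbound) (use C in \<open>auto simp: eventually_at_filter\<close>)
  qed
next
  case False
  show thesis
  proof (rule that[OF \<open>t0 < 0\<close>])
    fix s C assume s: "t0 < s" "s < 0" and C: "\<And>s'. s' < s \<Longrightarrow> f s' \<le> C"
    have "f 0 \<le> f ((t0 + s) / 2)" using False s by (force simp: not_less)
    moreover have "f s \<le> f 0" using monoD[OF mono] s by simp
    ultimately show "f s \<le> C" using C[of "(t0 + s) / 2"] s by simp
  qed
qed

text \<open>\<open>s1\<close> marks how far above \<open>t0\<close> the function \<open>f\<close> is known to be left continuous; its differentiability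
  enters the limit through this alone.\<close>

locale large_coupling_limit =
  fixes \<Omega> :: "'a::euclidean_space set" and f :: "real \<Rightarrow> real" and t0 s1 :: real
    and u :: "real \<Rightarrow> 'a \<Rightarrow> real"
  assumes open_domain: "open \<Omega>" and bounded_domain: "bounded \<Omega>"
    and f_mono: "mono f" and f_nonneg: "0 \<le> f t"
    and threshold: "t0 < 0" and f_pos: "t0 < t \<Longrightarrow> 0 < f t" and f_zero: "t < t0 \<Longrightarrow> f t = 0"
    and s1: "t0 < s1"
    and f_left: "t0 < s \<Longrightarrow> s < s1 \<Longrightarrow> (\<And>s'. s' < s \<Longrightarrow> f s' \<le> C) \<Longrightarrow> f s \<le> C"
    and solution: "l < 0 \<Longrightarrow> dirichlet_solution \<Omega> f l (u l)"
begin

lemma poisson: "l < 0 \<Longrightarrow> weak_poisson \<Omega> (u l) (\<lambda>x. - l * f (u l x))"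
  using dirichlet_solution_weak_poisson[OF open_domain bounded_domain f_mono f_nonneg solution] .

lemma solution_nonpos:
  assumes "l < 0" "x \<in> closure \<Omega>"
  shows "u l x \<le> 0"
proof (rule weak_maximum_principle[OF poisson[OF assms(1)] bounded_domain _ _ _ assms(2)])
  show "continuous_on (closure \<Omega>) (u l)" "y \<in> frontier \<Omega> \<Longrightarrow> u l y \<le> 0" for y
    using solution[OF assms(1)] by (auto simp: dirichlet_solution_def)
  show "0 \<le> - l * f (u l y)" for y using f_nonneg assms(1) by (simp add: mult_nonpos_nonneg)
qed

text \<open>Below \<open>t0\<close> the right hand side vanishes, so the maximum principle applies to \<open>- u l\<close> above the level \<open>- t0\<close>.\<close>

lemma solution_ge_threshold:
  assumes "l < 0" "x \<in> closure \<Omega>"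
  shows "t0 \<le> u l x"
proof -
  have "- u l x \<le> - t0"
  proof (rule weak_maximum_principle[OF weak_poisson_uminus[OF poisson[OF assms(1)]] bounded_domain _ _ _ assms(2)])
    show "continuous_on (closure \<Omega>) (\<lambda>x. - u l x)" "y \<in> frontier \<Omega> \<Longrightarrow> - u l y \<le> - t0" for y
      using solution[OF assms(1)] threshold by (auto simp: dirichlet_solution_def intro: continuous_on_minus)
    show "0 \<le> - (- l * f (u l y))" if "- t0 < - u l y" for y using f_zero that by simp
  qed
  then show ?thesis by simp
qed

lemma in_closure: "x \<in> \<Omega> \<Longrightarrow> x \<in> closure \<Omega>"
  using closure_subset by blast

lemma solution_growth:
  assumes "l < 0" "r > 0" "cball x r \<subseteq> \<Omega>" "s < u l x"
    "\<And>y. y \<in> \<Omega> \<Longrightarrow> s < u l y \<Longrightarrow> \<eta> \<le> - l * f (u l y)"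
    and M: "\<And>y. y \<in> cball x r \<Longrightarrow> u l y \<le> M"
  shows "\<eta> * r^2 \<le> 2 * real DIM('a) * (M - t0)"
proof -
  have "t0 \<le> u l x" using assms(1-3) by (intro solution_ge_threshold in_closure) auto
  then have "2 * real DIM('a) * (M - u l x) \<le> 2 * real DIM('a) * (M - t0)"
    by (intro mult_left_mono) auto
  then show ?thesis
    using subsolution_growth[OF poisson[OF assms(1)] assms(2-5) M] by linarith
qed

text \<open>If \<open>u l x > s > t0\<close>, then \<open>u l\<close> would rise by a multiple of \<open>- l * f s\<close>, but it stays between \<open>t0\<close> and \<open>0\<close>.\<close>

lemma eventually_near_threshold:
  assumes K: "compact K" "K \<subseteq> \<Omega>" and "e > 0"
  shows "\<forall>\<^sub>F l in at_bot. \<forall>x\<in>K. u l x \<le> t0 + e"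
proof -
  obtain r where "r > 0" and r: "(\<Union>x\<in>K. cball x r) \<subseteq> \<Omega>"
    using compact_subset_open_imp_cball_epsilon_subset[OF K(1) open_domain K(2)] by blast
  define s where "s = t0 + e"
  have "t0 < s" using \<open>e > 0\<close> by (simp add: s_def)
  define c where "c = min (- 1) (2 * real DIM('a) * t0 / (f s * r^2) - 1)"
  show ?thesis
  proof (rule eventually_at_bot_linorderI[of c], rule ballI)
    fix l x assume "l \<le> c" "x \<in> K"
    then have l: "l < 0" "l < 2 * real DIM('a) * t0 / (f s * r^2)" by (auto simp: c_def)
    have "f s * r^2 > 0" using f_pos[OF \<open>t0 < s\<close>] \<open>r > 0\<close> by simp
    then have large: "l * (f s * r^2) < 2 * real DIM('a) * t0" using l(2) by (simp add: pos_less_divide_eq)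
    have cball: "cball x r \<subseteq> \<Omega>" using r \<open>x \<in> K\<close> by blast
    have "u l x \<le> s"
    proof (rule ccontr)
      assume "\<not> u l x \<le> s"
      then have "s < u l x" by simp
      have "(- l * f s) * r^2 \<le> 2 * real DIM('a) * (0 - t0)"
      proof (rule solution_growth[OF l(1) \<open>r > 0\<close> cball \<open>s < u l x\<close>])
        show "- l * f s \<le> - l * f (u l y)" if "s < u l y" for y
          using l(1) monoD[OF f_mono, of s "u l y"] that by (intro mult_left_mono) auto
        show "u l y \<le> 0" if "y \<in> cball x r" for y
          using cball that by (intro solution_nonpos[OF l(1)] in_closure) blast
      qed
      then show False using large by simp
    qed
    then show "u l x \<le> t0 + e" by (simp add: s_def)
  qed
qed

text \<open>By uniform convergence \<open>u l\<close> can rise by at most \<open>e'\<close> above \<open>u l x\<close>, so the growth estimate bounds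
  \<open>- l * f s'\<close> for every \<open>s' < u l x\<close>, and left continuity turns this into a bound at \<open>u l x\<close>. If \<open>u l x = t0\<close>,
  where \<open>f\<close> may have a jump, then \<open>- l * f t0\<close> is itself a lower bound of the right hand side everywhere,
  since \<open>u l \<ge> t0\<close>.\<close>

lemma eventually_reaction_small:
  assumes K: "compact K" "K \<subseteq> \<Omega>" and "e > 0"
  shows "\<forall>\<^sub>F l in at_bot. \<forall>x\<in>K. - l * f (u l x) \<le> e"
proof -
  obtain r where "r > 0" and r: "(\<Union>x\<in>K. cball x r) \<subseteq> \<Omega>"
    using compact_subset_open_imp_cball_epsilon_subset[OF K(1) open_domain K(2)] by blast
  \<comment> \<open>the first bound keeps the values in the range of left continuity, the second absorbs the factor \<open>2 N / r\<^sup>2\<close>\<close>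
  define e' where "e' = min ((s1 - t0) / 2) (e * r^2 / (2 * real DIM('a)))"
  have "e' > 0" using s1 \<open>e > 0\<close> \<open>r > 0\<close> by (simp add: e'_def)
  have "t0 + e' < s1"
  proof -
    have "e' \<le> (s1 - t0) / 2" unfolding e'_def by (rule min.cobounded1)
    then show ?thesis using s1 by simp
  qed
  have e'_le: "2 * real DIM('a) * e' \<le> e * r^2"
  proof -
    have "e' \<le> e * r^2 / (2 * real DIM('a))" unfolding e'_def by (rule min.cobounded2)
    then show ?thesis by (simp add: pos_le_divide_eq mult.commute)
  qed
  have "\<forall>\<^sub>F l in at_bot. \<forall>x\<in>(\<Union>x\<in>K. cball x r). u l x \<le> t0 + e'"
    by (rule eventually_near_threshold[OF compact_minkowski_sum_cball[OF K(1)] r \<open>e' > 0\<close>])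
  then show ?thesis
    using eventually_gt_at_bot[of "0::real"]
  proof eventually_elim
    case (elim l)
    show ?case
    proof
      fix x assume x: "x \<in> K"
      have cball: "cball x r \<subseteq> \<Omega>" and le: "\<And>y. y \<in> cball x r \<Longrightarrow> u l y \<le> t0 + e'"
        using r x elim(1) by blast+
      have t0_le: "t0 \<le> u l y" if "y \<in> \<Omega>" for y
        using solution_ge_threshold[OF elim(2) in_closure[OF that]] .
      have \<eta>_le: "\<eta> \<le> e"
        if "s' < u l x" "\<And>y. y \<in> \<Omega> \<Longrightarrow> s' < u l y \<Longrightarrow> \<eta> \<le> - l * f (u l y)" for \<eta> s'
      proof -
        have "\<eta> * r^2 \<le> 2 * real DIM('a) * (t0 + e' - t0)"
          by (rule solution_growth[OF elim(2) \<open>r > 0\<close> cball that le])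
        then have "\<eta> * r^2 \<le> e * r^2" using e'_le by simp
        then show ?thesis using \<open>r > 0\<close> by simp
      qed
      have "x \<in> \<Omega>" using K(2) x by blast
      show "- l * f (u l x) \<le> e"
      proof (cases "u l x = t0")
        case True
        have "- l * f t0 \<le> e"
        \<comment> \<open>any level below \<open>t0\<close> serves, since the bound holds at all values of \<open>u l\<close>\<close>
        proof (rule \<eta>_le[of "t0 - 1"])
          show "- l * f t0 \<le> - l * f (u l y)" if "y \<in> \<Omega>" for y
            using elim(2) monoD[OF f_mono t0_le[OF that]] by (intro mult_left_mono) auto
        qed (use True in simp)
        then show ?thesis using True by simp
      next
        case False
        then have "t0 < u l x" using t0_le[OF \<open>x \<in> \<Omega>\<close>] by simp
        moreover have "u l x < s1" using le[of x] \<open>r > 0\<close> \<open>t0 + e' < s1\<close> by simp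
        moreover have "f s' \<le> e / - l" if "s' < u l x" for s'
        proof -
          have "- l * f s' \<le> e"
          proof (rule \<eta>_le[OF that])
            show "- l * f s' \<le> - l * f (u l y)" if "s' < u l y" for y
              using elim(2) monoD[OF f_mono, of s' "u l y"] that by (intro mult_left_mono) auto
          qed
          then show ?thesis using elim(2) by (subst pos_le_divide_eq) (simp_all add: mult.commute)
        qed
        ultimately have "f (u l x) \<le> e / - l" by (rule f_left)
        then show ?thesis using elim(2) by (subst (asm) pos_le_divide_eq) (simp_all add: mult.commute)
      qed
    qed
  qed
qed

lemma reaction_tendsto_0:
  assumes "x \<in> \<Omega>"
  shows "((\<lambda>l. l * f (u l x)) \<longlongrightarrow> 0) at_bot"
proof (rule tendstoI)
  fix e :: real assume "e > 0"
  have "\<forall>\<^sub>F l in at_bot. \<forall>y\<in>{x}. - l * f (u l y) \<le> e / 2"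
    using assms \<open>e > 0\<close> by (intro eventually_reaction_small) auto
  then show "\<forall>\<^sub>F l in at_bot. dist (l * f (u l x)) 0 < e"
    using eventually_gt_at_bot[of "0::real"]
  proof eventually_elim
    case (elim l)
    have "l * f (u l x) \<le> 0" using elim(2) f_nonneg by (simp add: mult_nonpos_nonneg)
    then show ?case using elim(1) \<open>e > 0\<close> by (simp add: dist_norm)
  qed
qed

lemma solution_C1:
  assumes "l < 0"
  shows "Ck_on 1 \<Omega> (u l)"
proof -
  have at_point: "u l differentiable (at x)" "i \<in> Basis \<Longrightarrow> continuous (at x) (partial i (u l))"
    if "x \<in> \<Omega>" for x i
  proof -
    obtain r' where "r' > 0" "cball x r' \<subseteq> \<Omega>"
      using open_domain \<open>x \<in> \<Omega>\<close> open_contains_cball by blast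
    define r where "r = r' / 3"
    have r: "r > 0" "cball x (3 * r) \<subseteq> \<Omega>" using \<open>r' > 0\<close> \<open>cball x r' \<subseteq> \<Omega>\<close> by (auto simp: r_def)
    have G: "\<bar>- l * f (u l y)\<bar> \<le> - l * f 0" and M: "\<bar>u l y - 0\<bar> \<le> - t0" if "y \<in> cball x (3 * r)" for y
    proof -
      have "y \<in> closure \<Omega>" using r(2) that in_closure by blast
      then have "t0 \<le> u l y" "u l y \<le> 0"
        using solution_nonpos[OF assms] solution_ge_threshold[OF assms] by auto
      then show "\<bar>u l y - 0\<bar> \<le> - t0" by simp
      have "f (u l y) \<le> f 0" using monoD[OF f_mono \<open>u l y \<le> 0\<close>] .
      then have "- l * f (u l y) \<le> - l * f 0" using assms by (intro mult_left_mono) auto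
      then show "\<bar>- l * f (u l y)\<bar> \<le> - l * f 0"
        using assms f_nonneg[of "u l y"] by (simp add: abs_mult)
    qed
    show "u l differentiable (at x)"
      by (rule weak_poisson_gradient(1)[OF poisson[OF assms] r G M]) (use r in auto)
    show "continuous (at x) (partial i (u l))" if "i \<in> Basis"
    proof -
      have "continuous_on (ball x r) (partial i (u l))"
        by (rule weak_poisson_gradient(2)[OF poisson[OF assms] r G M that])
      then show ?thesis using r by (simp add: continuous_on_eq_continuous_at)
    qed
  qed
  then show ?thesis
    unfolding Ck_on_1_iff using continuous_at_imp_continuous_on by blast
qed

lemma gradient_tendsto_0:
  assumes K: "compact K" "K \<subseteq> \<Omega>" and "i \<in> Basis" "e > 0"
  shows "\<forall>\<^sub>F l in at_bot. \<forall>x\<in>K. \<bar>partial i (u l) x\<bar> < e"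
proof -
  obtain r' where "r' > 0" and r': "(\<Union>x\<in>K. cball x r') \<subseteq> \<Omega>"
    using compact_subset_open_imp_cball_epsilon_subset[OF K(1) open_domain K(2)] by blast
  define r where "r = r' / 3"
  have "r > 0" and r: "(\<Union>x\<in>K. cball x (3 * r)) \<subseteq> \<Omega>"
    using \<open>r' > 0\<close> r' by (auto simp: r_def)
  let ?K = "\<Union>x\<in>K. cball x (3 * r)"
  define c where "c = DIM('a) / r + r / 2"
  have "c > 0" using \<open>r > 0\<close> by (simp add: c_def add_pos_pos)
  define \<delta> where "\<delta> = e / (2 * c)"
  have "\<delta> > 0" using \<open>e > 0\<close> \<open>c > 0\<close> by (simp add: \<delta>_def)
  have compact: "compact ?K" by (rule compact_minkowski_sum_cball[OF K(1)])
  show ?thesis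
    using eventually_near_threshold[OF compact r \<open>\<delta> > 0\<close>]
      eventually_reaction_small[OF compact r \<open>\<delta> > 0\<close>] eventually_gt_at_bot[of "0::real"]
  proof eventually_elim
    case (elim l)
    show ?case
    proof
      fix x assume x: "x \<in> K"
      have cball: "cball x (3 * r) \<subseteq> \<Omega>" using r x by blast
      have "\<bar>partial i (u l) x\<bar> \<le> DIM('a) * \<delta> / r + \<delta> * r / 2"
      proof (rule weak_poisson_gradient(3)[OF poisson[OF elim(3)] \<open>r > 0\<close> cball _ _ \<open>i \<in> Basis\<close>, where c = t0])
        fix y assume y: "y \<in> cball x (3 * r)"
        then have "u l y \<le> t0 + \<delta>" "- l * f (u l y) \<le> \<delta>" using elim(1,2) x by blast+
        moreover have "t0 \<le> u l y" using cball y in_closure by (intro solution_ge_threshold[OF elim(3)]) blast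
        moreover have "0 \<le> - l * f (u l y)" using elim(3) f_nonneg by (simp add: mult_nonpos_nonneg)
        ultimately show "\<bar>- l * f (u l y)\<bar> \<le> \<delta>" "\<bar>u l y - t0\<bar> \<le> \<delta>" by simp_all
      qed
      also have "\<dots> = \<delta> * c" by (simp add: c_def algebra_simps)
      also have "\<dots> = e / 2" using \<open>c > 0\<close> by (simp add: \<delta>_def)
      also have "\<dots> < e" using \<open>e > 0\<close> by simp
      finally show "\<bar>partial i (u l) x\<bar> < e" .
    qed
  qed
qed

lemma C1_convergence: "C1_loc_tendsto \<Omega> u (\<lambda>x. t0) at_bot"
  unfolding C1_loc_tendsto_def
proof (intro conjI allI impI ballI)
  show "\<forall>\<^sub>F l in at_bot. Ck_on 1 \<Omega> (u l)"
    using eventually_gt_at_bot[of "0::real"] by (rule eventually_mono) (rule solution_C1)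
  have const: "partial i (\<lambda>x. t0) = (\<lambda>x. 0)" for i :: 'a
    by (simp add: partial_def[abs_def])
  show "Ck_on 1 \<Omega> (\<lambda>x. t0)"
    by (simp add: Ck_on_1_iff const)
  fix K assume K: "compact K \<and> K \<subseteq> \<Omega>"
  show "uniform_limit K u (\<lambda>x. t0) at_bot"
  proof (rule uniform_limitI)
    fix e :: real assume "e > 0"
    have "\<forall>\<^sub>F l in at_bot. \<forall>x\<in>K. u l x \<le> t0 + e / 2"
      using K \<open>e > 0\<close> by (intro eventually_near_threshold) auto
    then show "\<forall>\<^sub>F l in at_bot. \<forall>x\<in>K. dist (u l x) t0 < e"
      using eventually_gt_at_bot[of "0::real"]
    proof eventually_elim
      case (elim l)
      show ?case
      proof
        fix x assume "x \<in> K"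
        then have "t0 \<le> u l x" using K by (intro solution_ge_threshold[OF elim(2)] in_closure) blast
        moreover have "u l x \<le> t0 + e / 2" using elim(1) \<open>x \<in> K\<close> by blast
        ultimately show "dist (u l x) t0 < e" using \<open>e > 0\<close> by (simp add: dist_norm)
      qed
    qed
  qed
  fix i :: 'a assume "i \<in> Basis"
  have "uniform_limit K (\<lambda>l. partial i (u l)) (\<lambda>x. 0) at_bot"
    using gradient_tendsto_0[OF _ _ \<open>i \<in> Basis\<close>] K by (intro uniform_limitI) simp
  then show "uniform_limit K (\<lambda>l x. frechet_derivative (u l) (at x) i)
      (\<lambda>x. frechet_derivative (\<lambda>x. t0) (at x) i) at_bot"
    unfolding const[of i, unfolded partial_def[abs_def]] partial_def[abs_def] .
qed

end

theorem proposition2p3: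
  fixes \<Omega> :: "(real ^ 'n) set" and f :: "real \<Rightarrow> real" and t0 :: real
    and u :: "real \<Rightarrow> real ^ 'n \<Rightarrow> real"
  assumes dim: "CARD('n) \<ge> 2"
    and dom: "smooth_bounded_domain \<Omega>"
    and f_nonneg: "\<And>t. 0 \<le> f t"
    and f_mono: "mono f"
    and f_0: "f 0 > 0"
    and f_C1: "\<exists>f'. (\<forall>t\<in>{t. 0 < f t \<and> f t < f 0}.
                   (f has_real_derivative f' t) (at t within {t. 0 < f t \<and> f t < f 0})) \<and>
                 continuous_on {t. 0 < f t \<and> f t < f 0} f'"
    and t0: "ereal t0 = (INF t\<in>{t. t < 0 \<and> f t > 0}. ereal t)"
    and sol: "\<And>l. l < 0 \<Longrightarrow> dirichlet_solution \<Omega> f l (u l)"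
    and uniq: "\<And>l v. l < 0 \<Longrightarrow> dirichlet_solution \<Omega> f l v \<Longrightarrow> (\<forall>x\<in>closure \<Omega>. v x = u l x)"
  shows "(AE x in lebesgue. x \<in> \<Omega> \<longrightarrow> ((\<lambda>l. l * f (u l x)) \<longlongrightarrow> 0) at_bot) \<and>
         C1_loc_tendsto \<Omega> u (\<lambda>x. t0) at_bot"
proof -
  let ?P = "{t. t < 0 \<and> f t > 0}"
  have "?P \<noteq> {}"
  proof
    assume "?P = {}"
    then have "ereal t0 = \<infinity>" using t0 by (simp only: image_empty Inf_empty top_ereal_def)
    then show False by simp
  qed
  have t0_le: "t0 \<le> t" if "t \<in> ?P" for t
    using INF_lower[OF that, of ereal] unfolding t0[symmetric] by simp
  have "t0 < 0"
    using \<open>?P \<noteq> {}\<close> t0_le by force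
  have pos: "0 < f t" if "t0 < t" for t
  proof -
    have "(INF t\<in>?P. ereal t) < ereal t" using that unfolding t0[symmetric] by simp
    then obtain t' where "t' \<in> ?P" "t' < t" by (auto simp: INF_less_iff)
    then show ?thesis using monoD[OF f_mono, of t' t] by simp
  qed
  have zero: "f t = 0" if "t < t0" for t
    using that t0_le[of t] \<open>t0 < 0\<close> f_nonneg[of t] by force
  obtain f' where f': "\<And>t. 0 < f t \<Longrightarrow> f t < f 0 \<Longrightarrow>
      (f has_real_derivative f' t) (at t within {t. 0 < f t \<and> f t < f 0})"
    using f_C1 by blast
  obtain s1 where s1: "t0 < s1"
    "\<And>s C. t0 < s \<Longrightarrow> s < s1 \<Longrightarrow> (\<And>s'. s' < s \<Longrightarrow> f s' \<le> C) \<Longrightarrow> f s \<le> C"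
    using left_continuous_above_threshold[OF f_mono pos \<open>t0 < 0\<close> f'] by blast
  interpret large_coupling_limit \<Omega> f t0 s1 u
  proof
    show "open \<Omega>" "bounded \<Omega>" using dom by (simp_all add: smooth_bounded_domain_def)
  qed (fact f_mono f_nonneg \<open>t0 < 0\<close> pos zero s1 sol)+
  show ?thesis
    using reaction_tendsto_0 C1_convergence by auto
qed

end
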